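(* Let $d \ge 2$, $h \ge 1$ be integers, and let $R_1,\dots,R_h$ be non-empty families of partitions of $[d]$ such that $P_1 \wedge \dots \wedge P_h$ is the discrete partition $\{\{1\},\dots,\{d\}\}$ for all $P_1 \in R_1, \dots, P_h \in R_h$. Then, for any integers $k_1, \dots, k_h \ge 1$, there exists an integer $C_{d,(R_1,\dots, R_h)}(k_1,\dots,k_h)$, depending only on $d,R_1,\dots,R_h,k_1,\dots,k_h$, such that for every field $\mathbb{F}$ and all positive integers $n_1,\dots,n_d$, if $T:[n_1]\times\dots\times[n_d]\to\mathbb{F}$ is an order-$d$ tensor with $R_i$-rank at most $k_i$ for each $i \in [h]$, then the tensor rank of $T$ is at most $C_{d,(R_1,\dots, R_h)}(k_1,\dots,k_h)$.
   Context: $[m]=\{1,\dots,m\}$; the parts of a partition are non-empty. $\mathbb{F}$ is an arbitrary field. For positive integers $n_1,\dots,n_d$, an order-$d$ tensor is a function $T:[n_1]\times\dots\times[n_d]\to\mathbb{F}$. For $x\in[n_1]\times\dots\times[n_d]$ and $J\subset[d]$, $x(J)\in\prod_{j\in J}[n_j]$ denotes the restriction of $x$ to its coordinates in $J$. $R$-rank: let $R$ be a non-empty family of partitions of $[d]$. An order-$d$ tensor $T$ has $R$-rank at most $1$ if there exist a partition $P\in R$ and, for each $J\in P$, a function $a_J:\prod_{j\in J}[n_j]\to\mathbb{F}$ such that $T(x)=\prod_{J\in P}a_J(x(J))$ for all $x$. The $R$-rank of $T$ is the smallest nonnegative integer $k$ such that $T=T_1+\dots+T_k$ for some order-$d$ tensors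 $T_1,\dots,T_k$ each of $R$-rank at most $1$ (the partition used may differ from one $T_i$ to another; the zero tensor has $R$-rank $0$). The tensor rank is the $R$-rank for $R=\{\{\{1\},\{2\},\dots,\{d\}\}\}$. Least common refinement: for partitions $P_1,\dots,P_h$ of $[d]$, $P_1\wedge\dots\wedge P_h=\{J_1\cap\dots\cap J_h: J_1\in P_1,\dots,J_h\in P_h, J_1\cap\dots\cap J_h\neq\emptyset\}$. *)

theory Defs
  imports "HOL-Algebra.Ring" "HOL-Library.Disjoint_Sets" "HOL-Library.FuncSet"
begin

text \<open>Multi-indices \<open>x\<close> are functions supported on their coordinate set, so that
  \<open>x(J)\<close> is \<open>restrict x J\<close>. A tensor is a function on multi-indices; its values
  off \<open>box {1..d} n\<close> are never inspected.\<close>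

definition box :: "nat set \<Rightarrow> (nat \<Rightarrow> nat) \<Rightarrow> (nat \<Rightarrow> nat) set" where
  "box J n = (\<Pi>\<^sub>E j\<in>J. {1..n j})"

definition tensors :: "('a, 'm) ring_scheme \<Rightarrow> nat \<Rightarrow> (nat \<Rightarrow> nat) \<Rightarrow> ((nat \<Rightarrow> nat) \<Rightarrow> 'a) set" where
  "tensors F d n = (box {1..d} n \<rightarrow> carrier F)"

definition R_rank_le_one ::
  "('a, 'm) ring_scheme \<Rightarrow> nat \<Rightarrow> (nat \<Rightarrow> nat) \<Rightarrow> nat set set set \<Rightarrow> ((nat \<Rightarrow> nat) \<Rightarrow> 'a) \<Rightarrow> bool" where
  "R_rank_le_one F d n R T \<longleftrightarrow>
     (\<exists>P\<in>R. \<exists>a. (\<forall>J\<in>P. a J \<in> box J n \<rightarrow> carrier F) \<and>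
        (\<forall>x\<in>box {1..d} n. T x = (\<Otimes>\<^bsub>F\<^esub>J\<in>P. a J (restrict x J))))"

definition R_rank ::
  "('a, 'm) ring_scheme \<Rightarrow> nat \<Rightarrow> (nat \<Rightarrow> nat) \<Rightarrow> nat set set set \<Rightarrow> ((nat \<Rightarrow> nat) \<Rightarrow> 'a) \<Rightarrow> nat" where
  "R_rank F d n R T =
     (LEAST k. \<exists>S. (\<forall>i\<in>{1..k}. S i \<in> tensors F d n \<and> R_rank_le_one F d n R (S i)) \<and>
        (\<forall>x\<in>box {1..d} n. T x = (\<Oplus>\<^bsub>F\<^esub>i\<in>{1..k}. S i x)))"

definition discrete_partition :: "nat \<Rightarrow> nat set set" where
  "discrete_partition d = (\<lambda>j. {j}) ` {1..d}"

definition tensor_rank ::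
  "('a, 'm) ring_scheme \<Rightarrow> nat \<Rightarrow> (nat \<Rightarrow> nat) \<Rightarrow> ((nat \<Rightarrow> nat) \<Rightarrow> 'a) \<Rightarrow> nat" where
  "tensor_rank F d n T = R_rank F d n {discrete_partition d} T"

text \<open>\<open>P\<^sub>1 \<and> \<dots> \<and> P\<^sub>h\<close> is \<^const>\<open>common_refinement\<close> of the set \<open>P ` {1..h}\<close>. Forgetting
  repetitions among the \<open>P\<^sub>i\<close> is harmless: two blocks of one partition are equal or disjoint.\<close>

definition bounds_tensor_rank ::
  "('a, 'm) ring_scheme \<Rightarrow> nat \<Rightarrow> nat \<Rightarrow> (nat \<Rightarrow> nat set set set) \<Rightarrow> (nat \<Rightarrow> nat) \<Rightarrow> nat \<Rightarrow> bool" where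
  "bounds_tensor_rank F d h R k C \<longleftrightarrow>
     (\<forall>n T. (\<forall>j\<in>{1..d}. n j \<ge> 1) \<longrightarrow> T \<in> tensors F d n \<longrightarrow>
        (\<forall>i\<in>{1..h}. R_rank F d n (R i) T \<le> k i) \<longrightarrow> tensor_rank F d n T \<le> C)"

text \<open>The constant \<open>C\<^bsub>d,(R\<^sub>1,\<dots>,R\<^sub>h)\<^esub>(k\<^sub>1,\<dots>,k\<^sub>h)\<close> has to serve all fields at once, but a
  HOL formula cannot quantify over the carrier type: in a theorem of the form
  \<open>\<exists>C. \<forall>F :: 'a ring. \<dots>\<close> the number \<open>C\<close> could still depend on \<open>'a\<close>. It is therefore
  introduced as a constant whose type does not mention the field, namely the least
  number that works for all fields with carrier in \<open>nat\<close>, i.e. (up to isomorphism) for all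
  countable fields. A number that works for all fields exists if and only if this one works
  for all fields: the entries of \<open>T\<close> and of one decomposition for each
  \<open>i\<close> generate a countable subfield, and the tensor rank does not
  increase when passing from a subfield to the whole field.\<close>

definition rank_constant :: "nat \<Rightarrow> nat \<Rightarrow> (nat \<Rightarrow> nat set set set) \<Rightarrow> (nat \<Rightarrow> nat) \<Rightarrow> nat" where
  "rank_constant d h R k =
     (LEAST C. \<forall>F :: nat ring. field F \<longrightarrow> bounds_tensor_rank F d h R k C)"

end

theory Submission
  imports Defs "HOL-Algebra.Generated_Fields" "HOL-Algebra.Weak_Morphisms"
    "HOL-Library.Countable_Set"
begin

text \<open>Write \<open>T\<close> as a sum of boundedly many products whose blocks come from a downward closed
  family \<open>\<D>\<close> of subsets of \<open>[d]\<close>, initially all subsets and the single product \<open>T\<close>. Pick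
  a maximal \<open>J \<in> \<D>\<close> with at least two elements. Since all common refinements are discrete,
  for some \<open>i\<close> no block of a partition in \<open>R\<^sub>i\<close> contains \<open>J\<close>. The terms using \<open>J\<close> add up to a
  function \<open>U\<close> which equals \<open>T\<close> minus the remaining terms; as \<open>J\<close> is maximal, the latter do not
  have a block containing \<open>J\<close> either. So the slices of \<open>U\<close> in the direction
  \<open>J\<close> are bounded sums of products that split \<open>J\<close> properly, and a skeleton decomposition of \<open>U\<close>
  replaces its factors on \<open>J\<close> by such slices. This removes \<open>J\<close> from \<open>\<D>\<close>; after at most
  \<open>2\<^sup>d\<close> rounds only singletons are left. The bound obtained depends neither on the field nor on
  its type, and descent to a countable subfield reduces the general case to carriers in
  \<open>nat\<close>.\<close>

subsection \<open>Sums of boundedly many functions\<close>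

text \<open>\<open>N\<close> only bounds the number of summands: \<open>weaken\<close> leaves slots
  empty, as \<open>A\<close> need not contain the zero function. Equality is required on
  \<open>X\<close> alone, because tensors are never inspected off their box.\<close>

inductive sum_of ::
  "('a, 'm) ring_scheme \<Rightarrow> 'x set \<Rightarrow> ('x \<Rightarrow> 'a) set \<Rightarrow> nat \<Rightarrow> ('x \<Rightarrow> 'a) \<Rightarrow> bool"
  for F X A where
  zero: "(\<And>x. x \<in> X \<Longrightarrow> f x = \<zero>\<^bsub>F\<^esub>) \<Longrightarrow> sum_of F X A 0 f"
| weaken: "sum_of F X A N f \<Longrightarrow> sum_of F X A (Suc N) f"
| add: "sum_of F X A N f \<Longrightarrow> g \<in> A \<Longrightarrow> (\<And>x. x \<in> X \<Longrightarrow> h x = f x \<oplus>\<^bsub>F\<^esub> g x)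
    \<Longrightarrow> sum_of F X A (Suc N) h"

lemma sum_of_cong:
  assumes "sum_of F X A N f" "\<And>x. x \<in> X \<Longrightarrow> f x = f' x"
  shows "sum_of F X A N f'"
  using assms
proof (induction arbitrary: f' rule: sum_of.induct)
  case (zero f)
  then show ?case by (simp add: sum_of.zero)
next
  case (weaken N f)
  then show ?case by (simp add: sum_of.weaken)
next
  case (add N f g h)
  show ?case
    by (rule sum_of.add[OF add.hyps(1,2)]) (use add.hyps(3) add.prems in simp)
qed

lemma sum_of_le:
  assumes "sum_of F X A N f" "N \<le> M"
  shows "sum_of F X A M f"
  using assms(2,1) by (induction rule: dec_induct) (auto intro: sum_of.weaken)

lemma sum_of_mono:
  assumes "sum_of F X A N f" "A \<subseteq> B"
  shows "sum_of F X B N f"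
  using assms by (induction rule: sum_of.induct) (auto intro: sum_of.intros)

context ring
begin

lemma sum_of_closed:
  assumes "sum_of R X A N f" "A \<subseteq> X \<rightarrow> carrier R"
  shows "f \<in> X \<rightarrow> carrier R"
  using assms by (induction rule: sum_of.induct) (auto simp: Pi_iff)

lemma sum_of_single:
  assumes "g \<in> A" "A \<subseteq> X \<rightarrow> carrier R"
  shows "sum_of R X A 1 g"
proof -
  have "sum_of R X A 0 (\<lambda>_. \<zero>)" by (rule sum_of.zero) simp
  from sum_of.add[OF this assms(1), of g] assms show ?thesis by (auto simp: Pi_iff)
qed

lemma sum_of_plus:
  assumes "sum_of R X A M g" "sum_of R X A N f" "A \<subseteq> X \<rightarrow> carrier R"
    and "\<And>x. x \<in> X \<Longrightarrow> h x = f x \<oplus> g x"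
  shows "sum_of R X A (M + N) h"
  using assms(1,4)
proof (induction arbitrary: h rule: sum_of.induct)
  case (zero g)
  have "f \<in> X \<rightarrow> carrier R" using sum_of_closed assms by blast
  then show ?case
    by (intro sum_of_cong[OF sum_of_le[OF assms(2)]]) (auto simp: zero Pi_iff)
next
  case (weaken N f)
  then show ?case by (simp add: sum_of.weaken)
next
  case (add M g1 g2 g)
  have f: "f \<in> X \<rightarrow> carrier R" and g1: "g1 \<in> X \<rightarrow> carrier R"
    using sum_of_closed assms add by blast+
  have "sum_of R X A (M + N) (\<lambda>x. f x \<oplus> g1 x)" by (rule add.IH) simp
  from sum_of.add[OF this add.hyps(2), of h] show ?case
    using add.hyps(2,3) add.prems f g1 assms(3) by (force simp: a_assoc Pi_iff)
qed

text \<open>An additive operator \<open>\<Phi>\<close> acts summand by summand. Sums are known only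
  on \<open>X\<close>, so the last two hypotheses also force \<open>\<Phi>\<close> to depend only on
  values there. Slicing, changing coordinates and multiplying by a fixed function are
  instances.\<close>

lemma sum_of_map:
  assumes "sum_of R X A N f" "A \<subseteq> X \<rightarrow> carrier R"
    and "\<And>g. g \<in> A \<Longrightarrow> \<Phi> g \<in> B"
    and "\<And>g y. y \<in> Y \<Longrightarrow> (\<And>x. x \<in> X \<Longrightarrow> g x = \<zero>) \<Longrightarrow> \<Phi> g y = \<zero>"
    and "\<And>f g h y. y \<in> Y \<Longrightarrow> f \<in> X \<rightarrow> carrier R \<Longrightarrow> g \<in> X \<rightarrow> carrier R
      \<Longrightarrow> (\<And>x. x \<in> X \<Longrightarrow> h x = f x \<oplus> g x) \<Longrightarrow> \<Phi> h y = \<Phi> f y \<oplus> \<Phi> g y"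
  shows "sum_of R Y B N (\<Phi> f)"
  using assms(1)
proof (induction rule: sum_of.induct)
  case (zero f)
  then show ?case using assms(4) by (intro sum_of.zero) blast
next
  case (weaken N f)
  then show ?case by (simp add: sum_of.weaken)
next
  case (add N f g h)
  have f: "f \<in> X \<rightarrow> carrier R" and g: "g \<in> X \<rightarrow> carrier R"
    using sum_of_closed add assms(2) by blast+
  show ?case
    using assms(5)[OF _ f g add.hyps(3)] by (rule sum_of.add[OF add.IH assms(3)[OF add.hyps(2)]])
qed

lemma sum_of_bind:
  assumes "sum_of R X A N f" "B \<subseteq> X \<rightarrow> carrier R"
    and "\<And>g. g \<in> A \<Longrightarrow> sum_of R X B M g"
  shows "sum_of R X B (N * M) f"
  using assms(1)
proof (induction rule: sum_of.induct)
  case (zero f)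
  then show ?case by (auto intro: sum_of.zero)
next
  case (weaken N f)
  then show ?case using sum_of_le[of R X B "N * M" f "Suc N * M"] by simp
next
  case (add N f g h)
  show ?case using sum_of_plus[OF assms(3)[OF add.hyps(2)] add.IH assms(2)] add.hyps(3) by simp
qed

text \<open>Each summand joins one of the two sums while the other is merely weakened; hence both
  parts keep the full bound \<open>N\<close>.\<close>

lemma sum_of_split:
  assumes "sum_of R X (A \<union> B) N f" "A \<subseteq> X \<rightarrow> carrier R" "B \<subseteq> X \<rightarrow> carrier R"
  shows "\<exists>g h. sum_of R X A N g \<and> sum_of R X B N h \<and> (\<forall>x\<in>X. f x = g x \<oplus> h x)"
  using assms(1)
proof (induction rule: sum_of.induct)
  case (zero f)
  have "sum_of R X C 0 (\<lambda>_. \<zero>)" for C by (rule sum_of.zero) simp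
  with zero show ?case by force
next
  case (weaken N f)
  then show ?case by (blast intro: sum_of.weaken)
next
  case (add N f e k)
  then obtain g h where gh: "sum_of R X A N g" "sum_of R X B N h" "\<forall>x\<in>X. f x = g x \<oplus> h x"
    by blast
  have cl: "g \<in> X \<rightarrow> carrier R" "h \<in> X \<rightarrow> carrier R" "e \<in> X \<rightarrow> carrier R"
    using gh sum_of_closed assms add.hyps(2) by blast+
  show ?case
  proof (cases "e \<in> A")
    case True
    have "sum_of R X A (Suc N) (\<lambda>x. g x \<oplus> e x)" by (rule sum_of.add[OF gh(1) True]) simp
    moreover have "k x = (g x \<oplus> e x) \<oplus> h x" if "x \<in> X" for x
      using that cl add.hyps(3) gh(3) by (simp add: Pi_iff a_ac)
    ultimately show ?thesis using sum_of.weaken[OF gh(2)] by blast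
  next
    case False
    with add.hyps(2) have "e \<in> B" by simp
    then have "sum_of R X B (Suc N) (\<lambda>x. h x \<oplus> e x)" by (rule sum_of.add[OF gh(2)]) simp
    moreover have "k x = g x \<oplus> (h x \<oplus> e x)" if "x \<in> X" for x
      using that cl add.hyps(3) gh(3) by (simp add: Pi_iff a_ac)
    ultimately show ?thesis using sum_of.weaken[OF gh(1)] by blast
  qed
qed

text \<open>Links the inductive notion to the indexed sums under the \<open>LEAST\<close> in
  \<open>R_rank\<close>; lengths \<open>k\<close> below \<open>N\<close> account for uses of
  \<open>weaken\<close>.\<close>

lemma sum_of_iff_finsum:
  assumes "A \<subseteq> X \<rightarrow> carrier R"
  shows "sum_of R X A N f \<longleftrightarrow>
    (\<exists>k\<le>N. \<exists>S. (\<forall>i\<in>{1..k}. S i \<in> A) \<and> (\<forall>x\<in>X. f x = (\<Oplus>i\<in>{1..k}. S i x)))"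
proof
  assume "sum_of R X A N f"
  then show "\<exists>k\<le>N. \<exists>S. (\<forall>i\<in>{1..k}. S i \<in> A) \<and> (\<forall>x\<in>X. f x = (\<Oplus>i\<in>{1..k}. S i x))"
  proof (induction rule: sum_of.induct)
    case (zero f)
    then show ?case by (intro exI[of _ 0]) auto
  next
    case (weaken N f)
    then show ?case using le_SucI by blast
  next
    case (add N f g h)
    then obtain k S where k: "k \<le> N" and S: "\<forall>i\<in>{1..k}. S i \<in> A"
      and f: "\<forall>x\<in>X. f x = (\<Oplus>i\<in>{1..k}. S i x)" by blast
    let ?S = "S(Suc k := g)"
    have "h x = (\<Oplus>i\<in>{1..Suc k}. ?S i x)" if x: "x \<in> X" for x
    proof -
      have *: "(\<lambda>i. S i x) \<in> {1..k} \<rightarrow> carrier R" "g x \<in> carrier R"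
        using S assms x add.hyps(2) by (auto simp: Pi_iff)
      then have "(\<Oplus>i\<in>{1..k}. ?S i x) \<in> carrier R" by (intro finsum_closed) auto
      moreover have "(\<Oplus>i\<in>{1..k}. ?S i x) = (\<Oplus>i\<in>{1..k}. S i x)"
        using * by (intro finsum_cong') auto
      moreover have "(\<Oplus>i\<in>insert (Suc k) {1..k}. ?S i x) = g x \<oplus> (\<Oplus>i\<in>{1..k}. ?S i x)"
        using * by (subst finsum_insert) (auto simp: Pi_iff)
      ultimately show ?thesis using x * f add.hyps(3)
        by (simp add: atLeastAtMostSuc_conv a_comm)
    qed
    moreover have "\<forall>i\<in>{1..Suc k}. ?S i \<in> A" using S add.hyps(2) by (auto simp: le_Suc_eq)
    ultimately show ?case using k by (meson Suc_le_mono)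
  qed
next
  assume "\<exists>k\<le>N. \<exists>S. (\<forall>i\<in>{1..k}. S i \<in> A) \<and> (\<forall>x\<in>X. f x = (\<Oplus>i\<in>{1..k}. S i x))"
  then obtain k S where k: "k \<le> N" and S: "\<forall>i\<in>{1..k}. S i \<in> A"
    and f: "\<forall>x\<in>X. f x = (\<Oplus>i\<in>{1..k}. S i x)" by blast
  have "sum_of R X A k f"
    using S f
  proof (induction k arbitrary: f)
    case 0
    then show ?case by (intro sum_of.zero) simp
  next
    case (Suc k)
    have "sum_of R X A k (\<lambda>x. \<Oplus>i\<in>{1..k}. S i x)" using Suc.prems(1) by (intro Suc.IH) auto
    then show ?case
    proof (rule sum_of.add)
      show "S (Suc k) \<in> A" using Suc.prems(1) by simp
      fix x assume x: "x \<in> X"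
      have "(\<lambda>i. S i x) \<in> {1..Suc k} \<rightarrow> carrier R"
        using Suc.prems(1) assms x by (auto simp: Pi_iff)
      then have *: "(\<lambda>i. S i x) \<in> {1..k} \<rightarrow> carrier R" "S (Suc k) x \<in> carrier R" by auto
      then have "(\<Oplus>i\<in>insert (Suc k) {1..k}. S i x) = S (Suc k) x \<oplus> (\<Oplus>i\<in>{1..k}. S i x)"
        by (subst finsum_insert) auto
      then show "f x = (\<Oplus>i\<in>{1..k}. S i x) \<oplus> S (Suc k) x"
        using Suc.prems(2) x * by (simp add: atLeastAtMostSuc_conv a_comm)
    qed
  qed
  then show "sum_of R X A N f" using k sum_of_le by blast
qed

end

lemma (in cring) sum_of_scale:
  assumes "sum_of R X A N f" "A \<subseteq> X \<rightarrow> carrier R" "c \<in> carrier R"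
    and "\<And>g. g \<in> A \<Longrightarrow> (\<lambda>x. c \<otimes> g x) \<in> A"
  shows "sum_of R X A N (\<lambda>x. c \<otimes> f x)"
  by (rule sum_of_map[OF assms(1,2)]) (use assms in \<open>auto simp: Pi_iff r_distr\<close>)

subsection \<open>Skeleton decompositions\<close>

text \<open>Skeleton (CUR) decomposition: if \<open>U(x, y) = \<Sum>\<^sub>j a\<^sub>j(x) h\<^sub>j(y)\<close>, then the \<open>a\<^sub>j\<close> can be
  replaced by columns \<open>U(\<cdot>, y')\<close>. One term \<open>a(x) g(y)\<close> is eliminated by
  subtracting \<open>U(x, z) g(y) / g(z)\<close> for some \<open>z\<close> with \<open>g(z) \<noteq> 0\<close>.\<close>

fun skeleton_bound :: "nat \<Rightarrow> nat \<Rightarrow> nat" where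
  "skeleton_bound 0 m = 0"
| "skeleton_bound (Suc r) m = skeleton_bound r m + (skeleton_bound r (m + m) * 2 + m)"

lemma (in field) skeleton_decomposition:
  fixes X :: "'x set" and Y :: "'y set"
  assumes G: "G \<subseteq> Y \<rightarrow> carrier R"
    and scale: "\<And>c g. c \<in> carrier R \<Longrightarrow> g \<in> G \<Longrightarrow> (\<lambda>y. c \<otimes> g y) \<in> G"
    and "sum_of R (X \<times> Y) {f. \<exists>a h. a \<in> X \<rightarrow> carrier R \<and> sum_of R Y G m h \<and>
      (\<forall>x\<in>X. \<forall>y\<in>Y. f (x, y) = a x \<otimes> h y)} r U"
  shows "sum_of R (X \<times> Y) {f. \<exists>y'\<in>Y. \<exists>g\<in>G. \<forall>x\<in>X. \<forall>y\<in>Y. f (x, y) = U (x, y') \<otimes> g y}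
      (skeleton_bound r m) U"
  using assms(3)
proof (induction r arbitrary: m U)
  case 0
  then show ?case by (auto elim: sum_of.cases intro: sum_of.zero)
next
  case (Suc r)
  let ?A = "\<lambda>m. {f. \<exists>a h. a \<in> X \<rightarrow> carrier R \<and> sum_of R Y G m h \<and>
      (\<forall>x\<in>X. \<forall>y\<in>Y. f (x, y) = a x \<otimes> h y)}"
  let ?B = "\<lambda>U. {f. \<exists>y'\<in>Y. \<exists>g\<in>G. \<forall>x\<in>X. \<forall>y\<in>Y. f (x, y) = U (x, y') \<otimes> g y}"
  have A_closed: "?A m \<subseteq> X \<times> Y \<rightarrow> carrier R" for m
  proof
    fix f assume "f \<in> ?A m"
    then obtain a h where "a \<in> X \<rightarrow> carrier R" "sum_of R Y G m h"
      "\<forall>x\<in>X. \<forall>y\<in>Y. f (x, y) = a x \<otimes> h y" by blast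
    moreover then have "h \<in> Y \<rightarrow> carrier R" using sum_of_closed G by blast
    ultimately show "f \<in> X \<times> Y \<rightarrow> carrier R" by (auto simp: Pi_iff)
  qed
  have U: "U \<in> X \<times> Y \<rightarrow> carrier R" using sum_of_closed[OF Suc.prems A_closed] .
  have B_closed: "?B V \<subseteq> X \<times> Y \<rightarrow> carrier R" if "V \<in> X \<times> Y \<rightarrow> carrier R" for V
    using that G by (fastforce simp: Pi_iff)
  from Suc.prems show ?case
  proof (cases rule: sum_of.cases)
    case weaken
    then show ?thesis using sum_of_le[OF Suc.IH] by simp
  next
    case (add V f)
    from add(2) obtain a g where a: "a \<in> X \<rightarrow> carrier R" and g: "sum_of R Y G m g"
      and f: "\<And>x y. x \<in> X \<Longrightarrow> y \<in> Y \<Longrightarrow> f (x, y) = a x \<otimes> g y" by blast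
    have g_closed: "g \<in> Y \<rightarrow> carrier R" using sum_of_closed[OF g G] .
    have V: "V \<in> X \<times> Y \<rightarrow> carrier R" using sum_of_closed[OF add(1) A_closed] .
    show ?thesis
    \<comment> \<open>If \<open>g\<close> vanishes, the term drops out and the induction hypothesis
      applies with the same \<open>m\<close>; this explains the first summand of
      \<open>skeleton_bound (Suc r) m\<close>.\<close>
    proof (cases "\<forall>y\<in>Y. g y = \<zero>")
      case True
      have "sum_of R (X \<times> Y) (?A m) r U"
        by (rule sum_of_cong[OF add(1)]) (use add(3) True f a V in \<open>auto simp: Pi_iff\<close>)
      then show ?thesis using sum_of_le[OF Suc.IH] by simp
    next
      case False
      then obtain z where z: "z \<in> Y" "g z \<noteq> \<zero>" by blast
      have gz: "g z \<in> carrier R" "inv (g z) \<in> carrier R" "inv (g z) \<otimes> g z = \<one>"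
        using z g_closed by (auto simp: Pi_iff field_Units)
      \<comment> \<open>\<open>?\<Phi>\<close> is linear, annihilates
        \<open>a x \<otimes> g y\<close>, and keeps the left factor \<open>b\<close> of any other
        term, whose right factor \<open>h\<close> becomes \<open>h\<close> minus a multiple of
        \<open>g\<close>: a sum of at most \<open>m + m\<close> members of \<open>G\<close>.\<close>
      let ?\<Phi> = "\<lambda>f (x, y). f (x, y) \<ominus> f (x, z) \<otimes> (inv (g z) \<otimes> g y)"
      have "sum_of R (X \<times> Y) (?A (m + m)) r (?\<Phi> V)"
      proof (rule sum_of_map[OF add(1) A_closed])
        fix f assume "f \<in> ?A m"
        then obtain b h where b: "b \<in> X \<rightarrow> carrier R" and h: "sum_of R Y G m h"
          and f: "\<And>x y. x \<in> X \<Longrightarrow> y \<in> Y \<Longrightarrow> f (x, y) = b x \<otimes> h y" by blast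
        have h_closed: "h \<in> Y \<rightarrow> carrier R" using sum_of_closed[OF h G] .
        let ?c = "\<ominus> (h z \<otimes> inv (g z))"
        have c: "?c \<in> carrier R" using h_closed z gz by (auto simp: Pi_iff)
        have "sum_of R Y G (m + m) (\<lambda>y. h y \<oplus> ?c \<otimes> g y)"
          by (rule sum_of_plus[OF sum_of_scale[OF g G c] h G]) (use scale c in auto)
        moreover have "?\<Phi> f (x, y) = b x \<otimes> (h y \<oplus> ?c \<otimes> g y)" if "x \<in> X" "y \<in> Y" for x y
        proof -
          have "b x \<in> carrier R" "h y \<in> carrier R" "g y \<in> carrier R" "h z \<in> carrier R"
            using that b h_closed g_closed z by (auto simp: Pi_iff)
          then show ?thesis using f that z gz
            by (simp add: r_distr minus_eq l_minus r_minus m_assoc)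
        qed
        ultimately show "?\<Phi> f \<in> ?A (m + m)" using b by blast
      next
        fix f :: "'x \<times> 'y \<Rightarrow> 'a" and p assume "p \<in> X \<times> Y" "\<And>p. p \<in> X \<times> Y \<Longrightarrow> f p = \<zero>"
        then show "?\<Phi> f p = \<zero>" using z gz g_closed by (auto simp: Pi_iff minus_eq)
      next
        fix f1 f2 f :: "'x \<times> 'y \<Rightarrow> 'a" and p
        assume *: "p \<in> X \<times> Y" "f1 \<in> X \<times> Y \<rightarrow> carrier R" "f2 \<in> X \<times> Y \<rightarrow> carrier R"
          "\<And>p. p \<in> X \<times> Y \<Longrightarrow> f p = f1 p \<oplus> f2 p"
        obtain x y where p: "p = (x, y)" by (cases p)
        have "f1 (x, y) \<in> carrier R" "f2 (x, y) \<in> carrier R" "f1 (x, z) \<in> carrier R"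
          "f2 (x, z) \<in> carrier R" "inv (g z) \<otimes> g y \<in> carrier R" 
          using * p z gz g_closed by (auto simp: Pi_iff)
        then show "?\<Phi> f p = ?\<Phi> f1 p \<oplus> ?\<Phi> f2 p"
          using * p z by (simp add: minus_eq l_distr minus_add a_ac)
      qed
      \<comment> \<open>\<open>U\<close> and \<open>V\<close> differ by the annihilated term, so
        \<open>?\<Phi> U\<close> inherits the shorter decomposition of
        \<open>?\<Phi> V\<close>.\<close>
      then have "sum_of R (X \<times> Y) (?A (m + m)) r (?\<Phi> U)"
      proof (rule sum_of_cong)
        fix p assume "p \<in> X \<times> Y"
        then obtain x y where p: "p = (x, y)" and xy: "x \<in> X" "y \<in> Y" by blast
        have cl: "V (x, y) \<in> carrier R" "V (x, z) \<in> carrier R" "a x \<in> carrier R" "g y \<in> carrier R"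
          using xy z V a g_closed by (auto simp: Pi_iff)
        have "a x \<otimes> g z \<otimes> (inv (g z) \<otimes> g y) = a x \<otimes> ((inv (g z) \<otimes> g z) \<otimes> g y)"
          using cl gz(1,2) by (simp add: m_ac)
        also have "\<dots> = a x \<otimes> g y" using cl gz by simp
        finally show "?\<Phi> V p = ?\<Phi> U p"
          using xy z cl gz add(3) f
          by (simp add: p l_distr minus_eq minus_add a_ac r_neg2)
      qed
      note \<Phi>U = Suc.IH[OF this]
      \<comment> \<open>A column of \<open>?\<Phi> U\<close> combines two columns of
        \<open>U\<close>, at \<open>y'\<close> and at \<open>z\<close>; the coefficient moves into
        the factor from \<open>G\<close>. Hence the factor 2 in the bound.\<close>
      have "sum_of R (X \<times> Y) (?B U) 2 f" if "f \<in> ?B (?\<Phi> U)" for f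
      proof -
        from that obtain y' e where y': "y' \<in> Y" and e: "e \<in> G"
          and f: "\<And>x y. x \<in> X \<Longrightarrow> y \<in> Y \<Longrightarrow> f (x, y) = ?\<Phi> U (x, y') \<otimes> e y" by auto
        let ?c = "\<ominus> (inv (g z) \<otimes> g y')"
        have c: "?c \<in> carrier R" using g_closed y' gz by (auto simp: Pi_iff)
        have 1: "sum_of R (X \<times> Y) (?B U) 1 (\<lambda>(x, y). U (x, y') \<otimes> e y)"
          by (rule sum_of_single[OF _ B_closed[OF U]]) (use y' e in auto)
        have 2: "sum_of R (X \<times> Y) (?B U) 1 (\<lambda>(x, y). U (x, z) \<otimes> (?c \<otimes> e y))"
          by (rule sum_of_single[OF _ B_closed[OF U]]) (use z scale[OF c e] in auto)
        have "sum_of R (X \<times> Y) (?B U) (1 + 1) f"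
        proof (rule sum_of_plus[OF 2 1 B_closed[OF U]])
          fix p assume "p \<in> X \<times> Y"
          then obtain x y where p: "p = (x, y)" and xy: "x \<in> X" "y \<in> Y" by blast
          have "U (x, y') \<in> carrier R" "U (x, z) \<in> carrier R" "e y \<in> carrier R"
            "g y' \<in> carrier R"
            using xy z y' U e G g_closed by (auto simp: Pi_iff)
          then show "f p = (case p of (v, w) \<Rightarrow> U (v, y') \<otimes> e w) \<oplus>
              (case p of (v, w) \<Rightarrow> U (v, z) \<otimes> (?c \<otimes> e w))"
            using f xy gz by (simp add: p minus_eq l_distr l_minus r_minus m_assoc)
        qed
        then show ?thesis by (simp add: numeral_2_eq_2)
      qed
      from sum_of_bind[OF \<Phi>U B_closed[OF U] this]
      have *: "sum_of R (X \<times> Y) (?B U) (skeleton_bound r (m + m) * 2) (?\<Phi> U)" by blast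
      \<comment> \<open>The subtracted matrix is added back. It uses only the column at
        \<open>z\<close> and costs \<open>m\<close> terms, because \<open>g\<close> is a sum of at
        most \<open>m\<close> members of \<open>G\<close>.\<close>
      have "sum_of R (X \<times> Y) (?B U) m (\<lambda>(x, y). U (x, z) \<otimes> (inv (g z) \<otimes> g y))"
        by (rule sum_of_map[OF g G])
          (use gz U z G scale[OF gz(2)] in \<open>auto simp: Pi_iff r_distr intro!: bexI[of _ z]\<close>)
      from sum_of_plus[OF * this B_closed[OF U], of U]
      have "sum_of R (X \<times> Y) (?B U) (skeleton_bound r (m + m) * 2 + m) U"
        using U z gz g_closed by (force simp: Pi_iff minus_eq a_ac r_neg r_neg1 r_neg2)
      then show ?thesis by (rule sum_of_le) simp
    qed
  qed
qed

subsection \<open>Products over the blocks of a partition\<close>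

text \<open>The scalar \<open>c\<close> allows scaling without touching a block. It also covers
  \<open>E = {}\<close>, where the product over the empty partition is 1; this case arises as the
  complement of a block \<open>J = E\<close>.\<close>

definition block_products ::
  "('a, 'm) ring_scheme \<Rightarrow> (nat \<Rightarrow> nat) \<Rightarrow> nat set \<Rightarrow> nat set set set \<Rightarrow> ((nat \<Rightarrow> nat) \<Rightarrow> 'a) set" where
  "block_products F n E \<P> = {f. \<exists>P\<in>\<P>. \<exists>c\<in>carrier F. \<exists>a.
     (\<forall>K\<in>P. a K \<in> box K n \<rightarrow> carrier F) \<and>
     (\<forall>x\<in>box E n. f x = c \<otimes>\<^bsub>F\<^esub> (\<Otimes>\<^bsub>F\<^esub>K\<in>P. a K (restrict x K)))}"

definition partitions_into :: "nat set \<Rightarrow> nat set set \<Rightarrow> nat set set set" where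
  "partitions_into E \<D> = {P. partition_on E P \<and> P \<subseteq> \<D>}"

text \<open>Inverse to splitting a multi-index into its parts on \<open>J\<close> and off
  \<open>J\<close>; it lets a tensor be read as a matrix with rows \<open>box J n\<close> and
  columns \<open>box (E - J) n\<close>.\<close>

definition merge :: "nat set \<Rightarrow> (nat \<Rightarrow> nat) \<Rightarrow> (nat \<Rightarrow> nat) \<Rightarrow> nat \<Rightarrow> nat" where
  "merge J u v = (\<lambda>j. if j \<in> J then u j else v j)"

lemma restrict_box: "x \<in> box E n \<Longrightarrow> K \<subseteq> E \<Longrightarrow> restrict x K \<in> box K n"
  by (auto simp: box_def PiE_def Pi_iff)

lemma merge_box:
  assumes "u \<in> box J n" "v \<in> box (E - J) n" "J \<subseteq> E"
  shows "merge J u v \<in> box E n"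
  using assms by (auto simp: box_def PiE_def Pi_iff merge_def extensional_def)

lemma merge_restrict:
  assumes "x \<in> box E n" "J \<subseteq> E"
  shows "merge J (restrict x J) (restrict x (E - J)) = x"
  using assms by (auto simp: box_def PiE_def merge_def extensional_def fun_eq_iff)

lemma restrict_merge:
  assumes "u \<in> box J n" "v \<in> box (E - J) n" "J \<subseteq> E"
  shows "restrict (merge J u v) J = u" "restrict (merge J u v) (E - J) = v"
  using assms by (auto simp: box_def PiE_def merge_def extensional_def fun_eq_iff)

lemma partition_on_subset: "partition_on E P \<Longrightarrow> K \<in> P \<Longrightarrow> K \<subseteq> E"
  by (auto simp: partition_on_def)

lemma partition_on_finite: "partition_on E P \<Longrightarrow> finite E \<Longrightarrow> finite P"
  by (metis finite_UnionD partition_on_def)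

lemma partitions_intoD:
  assumes "P \<in> partitions_into E \<D>"
  shows "partition_on E P" "P \<subseteq> \<D>"
  using assms by (auto simp: partitions_into_def)

lemma block_productsI:
  assumes "P \<in> \<P>" "c \<in> carrier F" "\<forall>K\<in>P. a K \<in> box K n \<rightarrow> carrier F"
    and "\<And>x. x \<in> box E n \<Longrightarrow> f x = c \<otimes>\<^bsub>F\<^esub> (\<Otimes>\<^bsub>F\<^esub>K\<in>P. a K (restrict x K))"
  shows "f \<in> block_products F n E \<P>"
  using assms unfolding block_products_def by blast

lemma block_products_mono: "\<P> \<subseteq> \<P>' \<Longrightarrow> block_products F n E \<P> \<subseteq> block_products F n E \<P>'"
  unfolding block_products_def by blast

lemma partitions_into_mono: "\<D> \<subseteq> \<D>' \<Longrightarrow> partitions_into E \<D> \<subseteq> partitions_into E \<D>'"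
  unfolding partitions_into_def by blast

context cring
begin

lemma block_factors_closed:
  assumes "\<forall>K\<in>P. a K \<in> box K n \<rightarrow> carrier R" "\<And>K. K \<in> P \<Longrightarrow> K \<subseteq> E" "x \<in> box E n"
  shows "(\<lambda>K. a K (restrict x K)) \<in> P \<rightarrow> carrier R"
proof
  fix K assume K: "K \<in> P"
  from restrict_box[OF assms(3) assms(2)[OF K]] show "a K (restrict x K) \<in> carrier R"
    using assms(1) K by (blast intro: funcset_mem)
qed

lemma block_products_closed:
  assumes "\<And>P. P \<in> \<P> \<Longrightarrow> partition_on E P"
  shows "block_products R n E \<P> \<subseteq> box E n \<rightarrow> carrier R"
proof
  fix f assume "f \<in> block_products R n E \<P>"
  then obtain P c a where P: "P \<in> \<P>" and c: "c \<in> carrier R"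
    and a: "\<forall>K\<in>P. a K \<in> box K n \<rightarrow> carrier R"
    and f: "\<forall>x\<in>box E n. f x = c \<otimes> (\<Otimes>K\<in>P. a K (restrict x K))"
    unfolding block_products_def by blast
  show "f \<in> box E n \<rightarrow> carrier R"
  proof
    fix x assume x: "x \<in> box E n"
    have "(\<Otimes>K\<in>P. a K (restrict x K)) \<in> carrier R"
      using block_factors_closed[OF a _ x] partition_on_subset[OF assms[OF P]]
      by (intro finprod_closed) blast
    then show "f x \<in> carrier R" using f x c by simp
  qed
qed

lemma partitions_into_closed:
  "block_products R n E (partitions_into E \<D>) \<subseteq> box E n \<rightarrow> carrier R"
  by (rule block_products_closed) (rule partitions_intoD(1))

lemma block_products_scale:
  assumes "f \<in> block_products R n E \<P>" "\<And>P. P \<in> \<P> \<Longrightarrow> partition_on E P" "c \<in> carrier R"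
  shows "(\<lambda>x. c \<otimes> f x) \<in> block_products R n E \<P>"
proof -
  from assms(1) obtain P b a where P: "P \<in> \<P>" "b \<in> carrier R"
    and a: "\<forall>K\<in>P. a K \<in> box K n \<rightarrow> carrier R"
    and f: "\<forall>x\<in>box E n. f x = b \<otimes> (\<Otimes>K\<in>P. a K (restrict x K))"
    unfolding block_products_def by blast
  have eq: "c \<otimes> f x = (c \<otimes> b) \<otimes> (\<Otimes>K\<in>P. a K (restrict x K))" if "x \<in> box E n" for x
  proof -
    have "(\<Otimes>K\<in>P. a K (restrict x K)) \<in> carrier R"
      using block_factors_closed[OF a _ that] partition_on_subset[OF assms(2)[OF P(1)]]
      by (intro finprod_closed) blast
    then show ?thesis using f that P assms(3) by (simp add: m_assoc)
  qed
  show ?thesis by (rule block_productsI[OF P(1) _ a eq]) (use P(2) assms(3) in simp_all)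
qed

lemma block_products_mult:
  assumes f: "f \<in> block_products R n E (partitions_into E \<D>)"
    and g: "g \<in> block_products R n E' (partitions_into E' \<D>)"
    and E: "finite E" "finite E'" "E \<inter> E' = {}"
    and h: "\<And>x. x \<in> box (E \<union> E') n \<Longrightarrow> h x = f (restrict x E) \<otimes> g (restrict x E')"
  shows "h \<in> block_products R n (E \<union> E') (partitions_into (E \<union> E') \<D>)"
proof -
  from f obtain P c a where P: "partition_on E P" "P \<subseteq> \<D>" and c: "c \<in> carrier R"
    and a: "\<forall>K\<in>P. a K \<in> box K n \<rightarrow> carrier R"
    and f: "\<forall>x\<in>box E n. f x = c \<otimes> (\<Otimes>K\<in>P. a K (restrict x K))"
    unfolding block_products_def partitions_into_def by blast
  from g obtain P' c' a' where P': "partition_on E' P'" "P' \<subseteq> \<D>" and c': "c' \<in> carrier R"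
    and a': "\<forall>K\<in>P'. a' K \<in> box K n \<rightarrow> carrier R"
    and g: "\<forall>x\<in>box E' n. g x = c' \<otimes> (\<Otimes>K\<in>P'. a' K (restrict x K))"
    unfolding block_products_def partitions_into_def by blast
  \<comment> \<open>Blocks are non-empty, so partitions of disjoint sets share none. Hence the
    combined family \<open>b\<close> restricts to both \<open>a\<close> and \<open>a'\<close>, and
    the product over the union splits.\<close>
  have disj: "P \<inter> P' = {}"
  proof (rule ccontr)
    assume "P \<inter> P' \<noteq> {}"
    then obtain K where K: "K \<in> P" "K \<in> P'" by blast
    then have "K \<subseteq> E \<inter> E'"
      using partition_on_subset[OF P(1)] partition_on_subset[OF P'(1)] by simp
    then have "K = {}" using E(3) by simp
    then show False using K(1) partition_onD3[OF P(1)] by simp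
  qed
  have part: "partition_on (E \<union> E') (P \<union> P')"
    using P(1) P'(1) E(3) by (auto simp: partition_on_def intro: disjoint_union)
  define b where "b K = (if K \<in> P then a K else a' K)" for K
  have b: "\<forall>K\<in>P \<union> P'. b K \<in> box K n \<rightarrow> carrier R"
    using a a' by (auto simp: b_def)
  have eq: "h x = (c \<otimes> c') \<otimes> (\<Otimes>K\<in>P \<union> P'. b K (restrict x K))" if x: "x \<in> box (E \<union> E') n" for x
  proof -
    have fac: "(\<lambda>K. b K (restrict x K)) \<in> P \<union> P' \<rightarrow> carrier R"
      using block_factors_closed[OF b _ x] partition_on_subset[OF part] by blast
    then have fac1: "(\<lambda>K. b K (restrict x K)) \<in> P \<rightarrow> carrier R"
      and fac2: "(\<lambda>K. b K (restrict x K)) \<in> P' \<rightarrow> carrier R" by auto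
    have "(\<Otimes>K\<in>P. a K (restrict (restrict x E) K)) = (\<Otimes>K\<in>P. b K (restrict x K))"
      using fac1 partition_on_subset[OF P(1)]
      by (intro finprod_cong') (auto simp: b_def Int_absorb1)
    moreover have "(\<Otimes>K\<in>P'. a' K (restrict (restrict x E') K)) = (\<Otimes>K\<in>P'. b K (restrict x K))"
      using fac2 partition_on_subset[OF P'(1)] disj
      by (intro finprod_cong') (auto simp: b_def Int_absorb1)
    moreover have "(\<Otimes>K\<in>P \<union> P'. b K (restrict x K))
        = (\<Otimes>K\<in>P. b K (restrict x K)) \<otimes> (\<Otimes>K\<in>P'. b K (restrict x K))"
      by (rule finprod_Un_disjoint[OF partition_on_finite[OF P(1) E(1)]
            partition_on_finite[OF P'(1) E(2)] disj fac1 fac2])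
    moreover have "(\<Otimes>K\<in>P. b K (restrict x K)) \<in> carrier R"
      "(\<Otimes>K\<in>P'. b K (restrict x K)) \<in> carrier R"
      using fac1 fac2 by (auto intro: finprod_closed)
    ultimately show ?thesis
      using h[OF x] f g restrict_box[OF x] c c' by (simp add: m_ac)
  qed
  have Q: "P \<union> P' \<in> partitions_into (E \<union> E') \<D>"
    using part P(2) P'(2) by (simp add: partitions_into_def)
  show ?thesis by (rule block_productsI[OF Q _ b eq]) (use c c' in simp_all)
qed

text \<open>Maximality of \<open>J\<close> in \<open>\<D>\<close> leaves two cases: \<open>J\<close>
  is itself a block and its factor splits off, or no block contains \<open>J\<close>.\<close>

lemma block_products_cases:
  assumes f: "f \<in> block_products R n E (partitions_into E \<D>)"
    and E: "finite E" and J: "J \<subseteq> E" and max: "\<And>K. K \<in> \<D> \<Longrightarrow> J \<subseteq> K \<Longrightarrow> K = J"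
  obtains (split) "f \<in> block_products R n E (partitions_into E (\<D> \<inter> {K. \<not> J \<subseteq> K}))"
  | (part) a g where "a \<in> box J n \<rightarrow> carrier R"
    "g \<in> block_products R n (E - J) (partitions_into (E - J) (\<D> - {J}))"
    "\<And>x. x \<in> box E n \<Longrightarrow> f x = a (restrict x J) \<otimes> g (restrict x (E - J))"
proof -
  from f obtain P c a where P: "partition_on E P" "P \<subseteq> \<D>" and c: "c \<in> carrier R"
    and a: "\<forall>K\<in>P. a K \<in> box K n \<rightarrow> carrier R"
    and f': "\<forall>x\<in>box E n. f x = c \<otimes> (\<Otimes>K\<in>P. a K (restrict x K))"
    unfolding block_products_def partitions_into_def by blast
  show thesis
  proof (cases "J \<in> P")
    case False
    then have PD: "P \<in> partitions_into E (\<D> \<inter> {K. \<not> J \<subseteq> K})"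
      using P max by (auto simp: partitions_into_def)
    show thesis using f' by (intro split block_productsI[OF PD c a]) blast
  next
    case True
    have part': "partition_on (E - J) (P - {J})"
      using P(1) True unfolding partition_on_def disjoint_def by blast
    let ?g = "\<lambda>x. c \<otimes> (\<Otimes>K\<in>P - {J}. a K (restrict x K))"
    show thesis
    proof (rule part)
      show "a J \<in> box J n \<rightarrow> carrier R" using a True by blast
      have "P - {J} \<in> partitions_into (E - J) (\<D> - {J})"
        using part' P(2) by (auto simp: partitions_into_def)
      then show "?g \<in> block_products R n (E - J) (partitions_into (E - J) (\<D> - {J}))"
        using a c unfolding block_products_def by blast
      fix x assume x: "x \<in> box E n"
      have fac: "(\<lambda>K. a K (restrict x K)) \<in> P \<rightarrow> carrier R"
        using block_factors_closed[OF a _ x] partition_on_subset[OF P(1)] by blast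
      have "(\<Otimes>K\<in>insert J (P - {J}). a K (restrict x K))
          = a J (restrict x J) \<otimes> (\<Otimes>K\<in>P - {J}. a K (restrict x K))"
        using fac True partition_on_finite[OF P(1) E] by (subst finprod_insert) auto
      moreover have "(\<Otimes>K\<in>P - {J}. a K (restrict (restrict x (E - J)) K))
          = (\<Otimes>K\<in>P - {J}. a K (restrict x K))"
        using fac partition_on_subset[OF part'] by (intro finprod_cong') (auto simp: Int_absorb1)
      moreover have "(\<Otimes>K\<in>P - {J}. a K (restrict x K)) \<in> carrier R" "a J (restrict x J) \<in> carrier R"
        using fac True by (auto intro!: finprod_closed)
      ultimately show "f x = a J (restrict x J) \<otimes> ?g (restrict x (E - J))"
        using f' x c True by (simp add: insert_absorb m_lcomm)
    qed
  qed
qed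

text \<open>With the coordinates outside \<open>J\<close> frozen at \<open>y\<close>, a block
  \<open>K\<close> meeting \<open>J\<close> becomes its trace \<open>J \<inter> K\<close>, and a
  block missing \<open>J\<close> becomes a scalar. As no block contains \<open>J\<close>, every
  trace is a proper subset of \<open>J\<close>.\<close>

lemma block_products_slice:
  assumes f: "f \<in> block_products R n E (partitions_into E {K. \<not> J \<subseteq> K})"
    and E: "finite E" and J: "J \<subseteq> E" and y: "y \<in> box (E - J) n"
  shows "(\<lambda>u. f (merge J u y)) \<in> block_products R n J (partitions_into J (Pow J - {J}))"
proof -
  from f obtain P c a where P: "partition_on E P" "P \<subseteq> {K. \<not> J \<subseteq> K}" and c: "c \<in> carrier R"
    and a: "\<forall>K\<in>P. a K \<in> box K n \<rightarrow> carrier R"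
    and f: "\<forall>x\<in>box E n. f x = c \<otimes> (\<Otimes>K\<in>P. a K (restrict x K))"
    unfolding block_products_def partitions_into_def by blast
  define P1 where "P1 = {K \<in> P. J \<inter> K \<noteq> {}}"
  define P0 where "P0 = {K \<in> P. J \<inter> K = {}}"
  define Q where "Q = (\<inter>) J ` P1"
  have fin: "finite P0" "finite P1" using partition_on_finite[OF P(1) E] unfolding P0_def P1_def by simp_all
  have "Q = (\<inter>) J ` P - {{}}" by (auto simp: Q_def P1_def)
  moreover have "J \<inter> E = J" using J by blast
  ultimately have "partition_on J Q" using partition_on_restrict[OF P(1), of J] by simp
  moreover have "Q \<subseteq> Pow J - {J}" using P(2) by (auto simp: Q_def P1_def)
  ultimately have Q: "Q \<in> partitions_into J (Pow J - {J})" by (simp add: partitions_into_def)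
  \<comment> \<open>Distinct blocks are disjoint, so a non-empty trace determines its block. This
    allows the product over \<open>P1\<close> to be reindexed by traces.\<close>
  have inj: "inj_on ((\<inter>) J) P1"
  proof (rule inj_onI)
    fix K L assume "K \<in> P1" "L \<in> P1" "J \<inter> K = J \<inter> L"
    then show "K = L"
      using P(1) unfolding partition_on_def disjoint_def P1_def by blast
  qed
  define block where "block = inv_into P1 ((\<inter>) J)"
  have block: "block (J \<inter> K) = K" if "K \<in> P1" for K
    using inj that by (simp add: block_def)
  define b where "b L w = a (block L) (restrict (merge J w y) (block L))" for L w
  define c0 where "c0 = c \<otimes> (\<Otimes>K\<in>P0. a K (restrict y K))"
  have y_box: "restrict y K \<in> box K n" if "K \<in> P0" for K
    using that y partition_on_subset[OF P(1)] by (intro restrict_box[OF y]) (auto simp: P0_def)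
  then have prod0: "(\<lambda>K. a K (restrict y K)) \<in> P0 \<rightarrow> carrier R"
    using a by (auto simp: P0_def Pi_iff)
  have b: "\<forall>L\<in>Q. b L \<in> box L n \<rightarrow> carrier R"
  proof (intro ballI funcsetI)
    fix L w assume "L \<in> Q" and w: "w \<in> box L n"
    then obtain K where K: "K \<in> P1" "L = J \<inter> K" by (auto simp: Q_def)
    have "restrict (merge J w y) K \<in> box K n"
      using w y partition_on_subset[OF P(1), of K] K
      by (auto simp: box_def merge_def PiE_def Pi_iff P1_def)
    then show "b L w \<in> carrier R" using a K block by (auto simp: b_def P1_def Pi_iff)
  qed
  have eq: "f (merge J u y) = c0 \<otimes> (\<Otimes>L\<in>Q. b L (restrict u L))" if u: "u \<in> box J n" for u
  proof -
    let ?x = "merge J u y"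
    have x: "?x \<in> box E n" using merge_box[OF u y J] .
    have fac: "(\<lambda>K. a K (restrict ?x K)) \<in> P \<rightarrow> carrier R"
      using block_factors_closed[OF a _ x] partition_on_subset[OF P(1)] by blast
    then have fac0: "(\<lambda>K. a K (restrict ?x K)) \<in> P0 \<rightarrow> carrier R"
      and fac1: "(\<lambda>K. a K (restrict ?x K)) \<in> P1 \<rightarrow> carrier R" by (auto simp: P0_def P1_def)
    have P10: "P = P1 \<union> P0" "P1 \<inter> P0 = {}" by (auto simp: P0_def P1_def)
    have "(\<Otimes>K\<in>P. a K (restrict ?x K))
        = (\<Otimes>K\<in>P1. a K (restrict ?x K)) \<otimes> (\<Otimes>K\<in>P0. a K (restrict ?x K))"
      unfolding P10(1) by (rule finprod_Un_disjoint[OF fin(2,1) P10(2) fac1 fac0])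
    moreover have "(\<Otimes>K\<in>P0. a K (restrict ?x K)) = (\<Otimes>K\<in>P0. a K (restrict y K))"
    proof (rule finprod_cong'[OF refl prod0])
      fix K assume "K \<in> P0"
      then have "restrict ?x K = restrict y K"
        by (auto simp: P0_def merge_def restrict_def fun_eq_iff)
      then show "a K (restrict ?x K) = a K (restrict y K)" by simp
    qed
    moreover have "(\<Otimes>K\<in>P1. a K (restrict ?x K)) = (\<Otimes>L\<in>Q. b L (restrict u L))"
    proof -
      have fb: "(\<lambda>L. b L (restrict u L)) \<in> Q \<rightarrow> carrier R"
        using block_factors_closed[OF b _ u] by (auto simp: Q_def)
      have "(\<Otimes>L\<in>Q. b L (restrict u L)) = (\<Otimes>K\<in>P1. b (J \<inter> K) (restrict u (J \<inter> K)))"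
        using fb inj unfolding Q_def by (rule finprod_reindex)
      also have "\<dots> = (\<Otimes>K\<in>P1. a K (restrict ?x K))"
      proof (rule finprod_cong'[OF refl fac1])
        fix K assume K: "K \<in> P1"
        have "restrict (merge J (restrict u (J \<inter> K)) y) K = restrict ?x K"
          by (auto simp: merge_def restrict_def fun_eq_iff)
        then show "b (J \<inter> K) (restrict u (J \<inter> K)) = a K (restrict ?x K)"
          using block[OF K] by (simp add: b_def)
      qed
      finally show ?thesis ..
    qed
    moreover have "(\<Otimes>K\<in>P1. a K (restrict ?x K)) \<in> carrier R"
      "(\<Otimes>K\<in>P0. a K (restrict y K)) \<in> carrier R"
      using fac1 prod0 by (auto intro: finprod_closed)
    ultimately show ?thesis using f x c by (simp add: c0_def m_ac)
  qed
  have c0: "c0 \<in> carrier R" using c prod0 by (simp add: c0_def)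
  show ?thesis by (rule block_productsI[OF Q c0 b eq])
qed

end

subsection \<open>Eliminating a maximal block\<close>

text \<open>Terms with block \<open>J\<close> sum to \<open>U\<close>, the others to
  \<open>W\<close>. The skeleton decomposition of \<open>U\<close> has
  \<open>skeleton_bound N 1\<close> terms, each a slice of \<open>U\<close> times a product over
  \<open>E - J\<close>; a slice costs \<open>N + k\<close> terms, and \<open>W\<close> adds
  \<open>N\<close>. By \<open>down\<close>, the new blocks, proper subsets of \<open>J\<close>, are
  admissible.\<close>

lemma (in field) block_products_step:
  assumes E: "finite E" and J: "J \<subseteq> E" "J \<in> \<D>"
    and max: "\<And>K. K \<in> \<D> \<Longrightarrow> J \<subseteq> K \<Longrightarrow> K = J" and down: "\<And>K. K \<subseteq> J \<Longrightarrow> K \<in> \<D>"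
    and fN: "sum_of R (box E n) (block_products R n E (partitions_into E \<D>)) N f"
    and fk: "sum_of R (box E n) (block_products R n E (partitions_into E {K. \<not> J \<subseteq> K})) k f"
  shows "sum_of R (box E n) (block_products R n E (partitions_into E (\<D> - {J})))
    (skeleton_bound N 1 * (N + k) + N) f"
proof -
  let ?T = "\<lambda>E \<D>. block_products R n E (partitions_into E \<D>)"
  let ?A = "{f. \<exists>a\<in>box J n \<rightarrow> carrier R. \<exists>g\<in>?T (E - J) (\<D> - {J}).
    \<forall>x\<in>box E n. f x = a (restrict x J) \<otimes> g (restrict x (E - J))}"
  let ?B = "?T E (\<D> \<inter> {K. \<not> J \<subseteq> K})"
  let ?X = "box J n" and ?Y = "box (E - J) n" and ?G = "?T (E - J) (\<D> - {J})"
  have restr: "restrict x J \<in> ?X" "restrict x (E - J) \<in> ?Y" if "x \<in> box E n" for x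
    using restrict_box[OF that] J(1) by auto
  have G: "?G \<subseteq> ?Y \<rightarrow> carrier R" by (rule partitions_into_closed)
  have A: "?A \<subseteq> box E n \<rightarrow> carrier R"
  proof
    fix f assume "f \<in> ?A"
    then obtain a g where "a \<in> ?X \<rightarrow> carrier R" "g \<in> ?G"
      and f: "\<forall>x\<in>box E n. f x = a (restrict x J) \<otimes> g (restrict x (E - J))" by blast
    then have "a \<in> ?X \<rightarrow> carrier R" "g \<in> ?Y \<rightarrow> carrier R" using G by auto
    then show "f \<in> box E n \<rightarrow> carrier R" using restr f by (auto simp: Pi_iff)
  qed
  have "?T E \<D> \<subseteq> ?A \<union> ?B"
  proof
    fix f assume "f \<in> ?T E \<D>"
    from this E J(1) max show "f \<in> ?A \<union> ?B" by (cases rule: block_products_cases) auto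
  qed
  from sum_of_split[OF sum_of_mono[OF fN this] A partitions_into_closed]
  obtain U W where U: "sum_of R (box E n) ?A N U" and W: "sum_of R (box E n) ?B N W"
    and f: "\<And>x. x \<in> box E n \<Longrightarrow> f x = U x \<oplus> W x" by blast
  have U_closed: "U \<in> box E n \<rightarrow> carrier R" by (rule sum_of_closed[OF U A])
  have W_closed: "W \<in> box E n \<rightarrow> carrier R" by (rule sum_of_closed[OF W partitions_into_closed])
  \<comment> \<open>Writing \<open>U\<close> as \<open>f\<close> minus \<open>W\<close> gives a
    second decomposition of \<open>U\<close>, of length \<open>N + k\<close>, in which no block
    contains \<open>J\<close>: for \<open>f\<close> this is \<open>fk\<close>, for \<open>W\<close>
    it holds as its terms lie in \<open>?B\<close>.\<close>
  have "?B \<subseteq> ?T E {K. \<not> J \<subseteq> K}"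
    by (intro block_products_mono partitions_into_mono) blast
  from sum_of_mono[OF W this]
  have "sum_of R (box E n) (?T E {K. \<not> J \<subseteq> K}) N (\<lambda>x. \<ominus> \<one> \<otimes> W x)"
    by (rule sum_of_scale[OF _ partitions_into_closed])
      (auto intro: block_products_scale partitions_intoD(1))
  from sum_of_plus[OF this fk partitions_into_closed, of U]
  have Uk: "sum_of R (box E n) (?T E {K. \<not> J \<subseteq> K}) (N + k) U"
    using f U_closed W_closed by (simp add: Pi_iff l_minus a_assoc r_neg)
  have slice: "sum_of R ?X (?T J (Pow J - {J})) (N + k) (\<lambda>u. U (merge J u y))" if y: "y \<in> ?Y" for y
    by (rule sum_of_map[OF Uk partitions_into_closed])
      (use block_products_slice[OF _ E J(1) y] merge_box[OF _ y J(1)] in auto)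
  \<comment> \<open>\<open>U\<close> is read as a matrix. The right factor of each term belongs to
    \<open>?G\<close> itself, whence the argument 1 of \<open>skeleton_bound\<close>.\<close>
  have "sum_of R (?X \<times> ?Y) {f. \<exists>a h. a \<in> ?X \<rightarrow> carrier R \<and> sum_of R ?Y ?G 1 h \<and>
      (\<forall>u\<in>?X. \<forall>v\<in>?Y. f (u, v) = a u \<otimes> h v)} N (\<lambda>(u, v). U (merge J u v))"
  proof (rule sum_of_map[OF U A])
    fix f assume "f \<in> ?A"
    then obtain a g where a: "a \<in> ?X \<rightarrow> carrier R" and g: "g \<in> ?G"
      and f: "\<forall>x\<in>box E n. f x = a (restrict x J) \<otimes> g (restrict x (E - J))" by blast
    have "\<forall>u\<in>?X. \<forall>v\<in>?Y. f (merge J u v) = a u \<otimes> g v"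
      using f merge_box[OF _ _ J(1)] restrict_merge[OF _ _ J(1)] by simp
    then show "(\<lambda>(u, v). f (merge J u v)) \<in> {f. \<exists>a h. a \<in> ?X \<rightarrow> carrier R \<and> sum_of R ?Y ?G 1 h \<and>
      (\<forall>u\<in>?X. \<forall>v\<in>?Y. f (u, v) = a u \<otimes> h v)}"
      using a sum_of_single[OF g G] by auto
  qed (use merge_box[OF _ _ J(1)] in auto)
  from skeleton_decomposition[OF G _ this] block_products_scale partitions_intoD(1)
  have "sum_of R (?X \<times> ?Y) {f. \<exists>y\<in>?Y. \<exists>g\<in>?G. \<forall>u\<in>?X. \<forall>v\<in>?Y. f (u, v) = U (merge J u y) \<otimes> g v}
      (skeleton_bound N 1) (\<lambda>(u, v). U (merge J u v))" (is "sum_of _ _ ?S _ _")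
    by fastforce
  then have "sum_of R (box E n) {f. \<exists>y\<in>?Y. \<exists>g\<in>?G. \<forall>x\<in>box E n.
      f x = U (merge J (restrict x J) y) \<otimes> g (restrict x (E - J))}
      (skeleton_bound N 1) (\<lambda>x. (\<lambda>(u, v). U (merge J u v)) (restrict x J, restrict x (E - J)))"
    (is "sum_of _ _ ?S' _ _")
  proof (rule sum_of_map)
    show "?S \<subseteq> ?X \<times> ?Y \<rightarrow> carrier R"
    proof clarify
      fix f u v y g assume "y \<in> ?Y" "g \<in> ?G" "u \<in> ?X" "v \<in> ?Y"
        "\<forall>u\<in>?X. \<forall>v\<in>?Y. f (u, v) = U (merge J u y) \<otimes> g v"
      then show "f (u, v) \<in> carrier R"
        using funcset_mem[OF U_closed merge_box[OF _ _ J(1)]] G by (simp add: subset_iff Pi_iff)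
    qed
  qed (use restr in \<open>(fastforce simp del: restrict_apply)+\<close>)
  then have "sum_of R (box E n) ?S' (skeleton_bound N 1) U"
    by (rule sum_of_cong) (simp add: merge_restrict[OF _ J(1)])
  then have "sum_of R (box E n) (?T E (\<D> - {J})) (skeleton_bound N 1 * (N + k)) U"
  proof (rule sum_of_bind[OF _ partitions_into_closed])
    fix f assume "f \<in> ?S'"
    then obtain y g where y: "y \<in> ?Y" and g: "g \<in> ?G"
      and f: "\<And>x. x \<in> box E n \<Longrightarrow> f x = U (merge J (restrict x J) y) \<otimes> g (restrict x (E - J))"
      by blast
    have gc: "g \<in> ?Y \<rightarrow> carrier R" using G g by blast
    have "sum_of R (box E n) (?T E (\<D> - {J})) (N + k)
        (\<lambda>x. (\<lambda>u. U (merge J u y)) (restrict x J) \<otimes> g (restrict x (E - J)))"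
    proof (rule sum_of_map[OF slice[OF y] partitions_into_closed])
      \<comment> \<open>A slice has only proper subsets of \<open>J\<close> as blocks; together with
        the blocks of \<open>g\<close> they partition all of \<open>E\<close> without using
        \<open>J\<close>.\<close>
      fix p assume "p \<in> ?T J (Pow J - {J})"
      moreover have "?T J (Pow J - {J}) \<subseteq> ?T J (\<D> - {J})"
        using down by (intro block_products_mono partitions_into_mono) auto
      ultimately have "p \<in> ?T J (\<D> - {J})" by blast
      from block_products_mult[OF this g _ _ _ refl] E J(1) finite_subset
      show "(\<lambda>x. p (restrict x J) \<otimes> g (restrict x (E - J))) \<in> ?T E (\<D> - {J})"
        by (simp add: Un_absorb1 finite_subset)
    qed (use restr gc in \<open>auto simp: Pi_iff l_distr simp del: restrict_apply\<close>)
    then show "sum_of R (box E n) (?T E (\<D> - {J})) (N + k) f"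
      by (rule sum_of_cong) (simp add: f)
  qed
  moreover have "?B \<subseteq> ?T E (\<D> - {J})"
    using max by (intro block_products_mono partitions_into_mono) blast
  from sum_of_mono[OF W this] have "sum_of R (box E n) (?T E (\<D> - {J})) N W" .
  ultimately show ?thesis
    by (rule sum_of_plus[OF _ _ partitions_into_closed])
      (use f U_closed W_closed in \<open>auto simp: Pi_iff a_comm\<close>)
qed

text \<open>Every step removes one admissible block, so \<open>m\<close> bounds the size of a
  family of admissible blocks; the summand \<open>N\<close> covers the case that all remaining blocks
  have at most one element.\<close>

fun reduction_bound :: "nat \<Rightarrow> nat \<Rightarrow> nat \<Rightarrow> nat" where
  "reduction_bound k 0 N = N"
| "reduction_bound k (Suc m) N = N + reduction_bound k m (skeleton_bound N 1 * (N + k) + N)"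

text \<open>Induction on a bound \<open>m\<close> for the number of admissible blocks, removing a
  maximal one each time. Since \<open>split\<close> offers the same \<open>k\<close> for all
  \<open>J\<close>, the bound does not depend on which blocks are chosen.\<close>

lemma (in field) block_products_reduce:
  assumes E: "finite E" and "\<D> \<subseteq> Pow E" and "\<And>K L. K \<in> \<D> \<Longrightarrow> L \<subseteq> K \<Longrightarrow> L \<in> \<D>"
    and split: "\<And>J. J \<subseteq> E \<Longrightarrow> 2 \<le> card J \<Longrightarrow>
      sum_of R (box E n) (block_products R n E (partitions_into E {K. \<not> J \<subseteq> K})) k f"
    and "sum_of R (box E n) (block_products R n E (partitions_into E \<D>)) N f"
    and "card \<D> \<le> m"
  shows "sum_of R (box E n) (block_products R n E (partitions_into E {K. card K \<le> 1}))
    (reduction_bound k m N) f"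
  using assms(2,3,5,6)
proof (induction m arbitrary: \<D> N)
  case 0
  then have "\<D> = {}" using E by (simp add: finite_subset)
  with 0 show ?case
    using sum_of_mono[OF 0(3) block_products_mono[OF partitions_into_mono[of \<D>]]] by simp
next
  case (Suc m)
  have fin: "finite \<D>" using Suc.prems(1) E by (simp add: finite_subset)
  show ?case
  proof (cases "\<exists>K\<in>\<D>. 2 \<le> card K")
    case False
    then have "\<D> \<subseteq> {K. card K \<le> 1}" by force
    from sum_of_mono[OF Suc.prems(3) block_products_mono[OF partitions_into_mono[OF this]]]
    show ?thesis by (rule sum_of_le) simp
  next
    case True
    then obtain K where K: "K \<in> \<D>" "2 \<le> card K" by blast
    \<comment> \<open>\<open>J\<close> is maximal in all of \<open>\<D>\<close> and inherits at
      least two elements from \<open>K\<close>.\<close>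
    from finite_has_maximal2[OF fin K(1)] obtain J where J: "J \<in> \<D>" "K \<subseteq> J"
      and "\<forall>L\<in>\<D>. J \<subseteq> L \<longrightarrow> J = L" by (elim bexE conjE)
    then have max: "L = J" if "L \<in> \<D>" "J \<subseteq> L" for L using that by blast
    have JE: "J \<subseteq> E" using J Suc.prems(1) by blast
    have "2 \<le> card J" using K(2) card_mono[OF finite_subset[OF JE E] J(2)] by simp
    from block_products_step[OF E JE J(1) max Suc.prems(2)[OF J(1)] Suc.prems(3) split[OF JE this]]
    have "sum_of R (box E n) (block_products R n E (partitions_into E (\<D> - {J})))
      (skeleton_bound N 1 * (N + k) + N) f" .
    moreover have "card (\<D> - {J}) \<le> m" using J(1) fin Suc.prems(4) by simp
    \<comment> \<open>Downward closure survives the removal: a remaining set with \<open>J\<close>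
      as a subset would equal \<open>J\<close> by maximality.\<close>
    moreover have "L \<in> \<D> - {J}" if "K \<in> \<D> - {J}" "L \<subseteq> K" for K L
      using that Suc.prems(2)[of K L] max[of K] by auto
    moreover have "\<D> - {J} \<subseteq> Pow E" using Suc.prems(1) by blast
    ultimately have "sum_of R (box E n) (block_products R n E (partitions_into E {K. card K \<le> 1}))
      (reduction_bound k m (skeleton_bound N 1 * (N + k) + N)) f"
      by (intro Suc.IH)
    then show ?thesis by (rule sum_of_le) simp
  qed
qed

subsection \<open>Ranks as sums of block products\<close>

context cring
begin

text \<open>The indicator of \<open>z\<close> is the product over the blocks of the indicators of
  agreement with \<open>z\<close> there: the blocks cover \<open>E\<close>, so any other point of
  the box disagrees on some block.\<close>

lemma block_products_indicator:
  assumes P: "P \<in> \<P>" "partition_on E P" and E: "finite E" and z: "z \<in> box E n"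
    and c: "c \<in> carrier R"
  shows "(\<lambda>x. if x = z then c else \<zero>) \<in> block_products R n E \<P>"
proof (rule block_productsI[OF P(1) c])
  let ?a = "\<lambda>K w. if w = restrict z K then \<one> else \<zero>"
  show a: "\<forall>K\<in>P. ?a K \<in> box K n \<rightarrow> carrier R" by auto
  fix x assume x: "x \<in> box E n"
  have fac: "(\<lambda>K. ?a K (restrict x K)) \<in> P \<rightarrow> carrier R" by auto
  show "(if x = z then c else \<zero>) = c \<otimes> (\<Otimes>K\<in>P. ?a K (restrict x K))"
  proof (cases "x = z")
    case True
    then show ?thesis using c by simp
  next
    case False
    then obtain j where "x j \<noteq> z j" by blast
    moreover then have "j \<in> E" using x z unfolding box_def by (metis PiE_arb)
    ultimately obtain K where K: "K \<in> P" "restrict x K \<noteq> restrict z K"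
      using P(2) unfolding partition_on_def by (metis UnionE restrict_apply')
    have "(\<Otimes>K\<in>insert K (P - {K}). ?a K (restrict x K))
        = ?a K (restrict x K) \<otimes> (\<Otimes>K\<in>P - {K}. ?a K (restrict x K))"
      using partition_on_finite[OF P(2) E] by (intro finprod_insert) auto
    moreover have "(\<Otimes>K\<in>P - {K}. ?a K (restrict x K)) \<in> carrier R"
      by (intro finprod_closed) auto
    moreover have "insert K (P - {K}) = P" using K(1) by blast
    ultimately have "(\<Otimes>K\<in>P. ?a K (restrict x K)) = \<zero>"
      using K(2) by simp
    then show ?thesis using False c by simp
  qed
qed

text \<open>A tensor on a finite box is a sum of scaled point indicators. Existence of some
  decomposition makes the \<open>LEAST\<close> in \<open>R_rank\<close> an attained minimum.\<close>

lemma exists_sum_of_block_products: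
  assumes P: "P \<in> \<P>" and \<P>: "\<And>P. P \<in> \<P> \<Longrightarrow> partition_on E P" and E: "finite E"
    and T: "T \<in> box E n \<rightarrow> carrier R"
  shows "\<exists>N. sum_of R (box E n) (block_products R n E \<P>) N T"
proof -
  have "finite (box E n)" using E by (simp add: box_def finite_PiE)
  moreover have "sum_of R (box E n) (block_products R n E \<P>) (card Z) (\<lambda>x. if x \<in> Z then T x else \<zero>)"
    if "finite Z" "Z \<subseteq> box E n" for Z
    using that
  proof (induction rule: finite_induct)
    case empty
    then show ?case by (auto intro: sum_of.zero)
  next
    case (insert z Z)
    have "T z \<in> carrier R" using insert.prems T by blast
    moreover have z: "z \<in> box E n" using insert.prems by blast
    ultimately have "(\<lambda>x. if x = z then T z else \<zero>) \<in> block_products R n E \<P>"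
      using block_products_indicator P \<P> E by blast
    from sum_of.add[OF insert.IH this, of "\<lambda>x. if x \<in> insert z Z then T x else \<zero>"] show ?case
      using insert.prems insert.hyps T by (auto simp: Pi_iff)
  qed
  ultimately have "sum_of R (box E n) (block_products R n E \<P>) (card (box E n))
      (\<lambda>x. if x \<in> box E n then T x else \<zero>)" by blast
  then have "sum_of R (box E n) (block_products R n E \<P>) (card (box E n)) T"
    by (rule sum_of_cong) simp
  then show ?thesis ..
qed

text \<open>The scalar allowed in \<open>block_products\<close> is absorbed into the factor of one
  block \<open>L\<close>, which exists because \<open>d \<ge> 1\<close>.\<close>

lemma rank_le_one_block_products:
  assumes \<P>: "\<And>P. P \<in> \<P> \<Longrightarrow> partition_on {1..d} P" and d: "d \<ge> 1"
  shows "S \<in> tensors R d n \<and> R_rank_le_one R d n \<P> S \<longleftrightarrow> S \<in> block_products R n {1..d} \<P>"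
proof
  assume "S \<in> tensors R d n \<and> R_rank_le_one R d n \<P> S"
  then obtain P a where S: "S \<in> box {1..d} n \<rightarrow> carrier R" and P: "P \<in> \<P>"
    and a: "\<forall>J\<in>P. a J \<in> box J n \<rightarrow> carrier R"
    and eq: "\<forall>x\<in>box {1..d} n. S x = (\<Otimes>J\<in>P. a J (restrict x J))"
    unfolding tensors_def R_rank_le_one_def by blast
  show "S \<in> block_products R n {1..d} \<P>"
  proof (rule block_productsI[OF P one_closed a])
    fix x assume x: "x \<in> box {1..d} n"
    show "S x = \<one> \<otimes> (\<Otimes>K\<in>P. a K (restrict x K))"
      using eq x funcset_mem[OF S x] by simp
  qed
next
  assume S: "S \<in> block_products R n {1..d} \<P>"
  then obtain P c a where P: "P \<in> \<P>" and c: "c \<in> carrier R"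
    and a: "\<forall>K\<in>P. a K \<in> box K n \<rightarrow> carrier R"
    and eq: "\<forall>x\<in>box {1..d} n. S x = c \<otimes> (\<Otimes>K\<in>P. a K (restrict x K))"
    unfolding block_products_def by blast
  have "P \<noteq> {}" using \<P>[OF P] d by (auto simp: partition_on_def)
  then obtain L where L: "L \<in> P" by blast
  define b where "b = a(L := \<lambda>w. c \<otimes> a L w)"
  have b: "\<forall>K\<in>P. b K \<in> box K n \<rightarrow> carrier R"
    using a c L by (auto simp: b_def Pi_iff)
  have "S x = (\<Otimes>K\<in>P. b K (restrict x K))" if x: "x \<in> box {1..d} n" for x
  proof -
    have fa: "(\<lambda>K. a K (restrict x K)) \<in> P \<rightarrow> carrier R"
      and fb: "(\<lambda>K. b K (restrict x K)) \<in> P \<rightarrow> carrier R"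
      using block_factors_closed[OF a _ x] block_factors_closed[OF b _ x]
        partition_on_subset[OF \<P>[OF P]] by blast+
    have fin: "finite P" using partition_on_finite[OF \<P>[OF P]] by simp
    have P_L: "insert L (P - {L}) = P" using L by blast
    have "(\<Otimes>K\<in>insert L (P - {L}). a K (restrict x K))
        = a L (restrict x L) \<otimes> (\<Otimes>K\<in>P - {L}. a K (restrict x K))"
      using fa fin L by (intro finprod_insert) auto
    moreover have "(\<Otimes>K\<in>insert L (P - {L}). b K (restrict x K))
        = b L (restrict x L) \<otimes> (\<Otimes>K\<in>P - {L}. b K (restrict x K))"
      using fb fin L by (intro finprod_insert) auto
    moreover have "(\<Otimes>K\<in>P - {L}. b K (restrict x K)) = (\<Otimes>K\<in>P - {L}. a K (restrict x K))"
      using fa by (intro finprod_cong') (auto simp: b_def)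
    moreover have "a L (restrict x L) \<in> carrier R" "(\<Otimes>K\<in>P - {L}. a K (restrict x K)) \<in> carrier R"
      using fa L by (auto intro!: finprod_closed)
    ultimately show ?thesis
      using eq x c unfolding P_L by (simp add: b_def m_assoc)
  qed
  moreover have "S \<in> tensors R d n"
    using S block_products_closed[OF \<P>] unfolding tensors_def by blast
  ultimately show "S \<in> tensors R d n \<and> R_rank_le_one R d n \<P> S"
    using P b unfolding R_rank_le_one_def by blast
qed

text \<open>A sum with bound \<open>N\<close> is a decomposition of some exact length at most
  \<open>N\<close>. As decompositions exist, this amounts to the least length being at most
  \<open>N\<close>, so rank bounds become statements about \<open>sum_of\<close>.\<close>

lemma R_rank_le_iff_sum_of:
  assumes \<P>: "\<And>P. P \<in> \<P> \<Longrightarrow> partition_on {1..d} P" "\<P> \<noteq> {}" and d: "d \<ge> 1"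
    and T: "T \<in> tensors R d n"
  shows "R_rank R d n \<P> T \<le> N
    \<longleftrightarrow> sum_of R (box {1..d} n) (block_products R n {1..d} \<P>) N T"
proof -
  define Q where "Q k \<longleftrightarrow> (\<exists>S. (\<forall>i\<in>{1..k}. S i \<in> block_products R n {1..d} \<P>) \<and>
    (\<forall>x\<in>box {1..d} n. T x = (\<Oplus>i\<in>{1..k}. S i x)))" for k :: nat
  have sum_of_Q: "sum_of R (box {1..d} n) (block_products R n {1..d} \<P>) M T \<longleftrightarrow> (\<exists>k\<le>M. Q k)" for M
    unfolding Q_def by (rule sum_of_iff_finsum[OF block_products_closed[OF \<P>(1)]])
  have rank: "R_rank R d n \<P> T = (LEAST k. Q k)"
    using \<P>(1) d by (simp add: R_rank_def Q_def rank_le_one_block_products)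
  obtain P where "P \<in> \<P>" using \<P>(2) by blast
  from exists_sum_of_block_products[OF this \<P>(1) _ T[unfolded tensors_def]]
  have "\<exists>k. Q k" using sum_of_Q by auto
  then have "Q (LEAST k. Q k)" by (rule LeastI_ex)
  then show ?thesis
    unfolding rank sum_of_Q by (meson Least_le order_trans)
qed

end

lemma (in cring) tensor_rank_le_iff_sum_of:
  assumes "d \<ge> 1" "T \<in> tensors R d n"
  shows "tensor_rank R d n T \<le> N
    \<longleftrightarrow> sum_of R (box {1..d} n) (block_products R n {1..d} {discrete_partition d}) N T"
  unfolding tensor_rank_def
  by (rule R_rank_le_iff_sum_of)
    (use assms in \<open>auto simp: discrete_partition_def partition_on_singletons\<close>)

section \<open>From discrete common refinements to a bound over a given field\<close>

text \<open>Otherwise every \<open>\<R> i\<close> would contain a partition with a block above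
  \<open>J\<close>. The intersection of these blocks would be a block of the common refinement
  containing \<open>J\<close>, hence not a singleton.\<close>

lemma not_coarser_of_common_refinement:
  assumes ref: "\<And>P. (\<And>i. i \<in> {1..h::nat} \<Longrightarrow> P i \<in> \<R> i) \<Longrightarrow>
      common_refinement (P ` {1..h}) = discrete_partition d"
    and J: "2 \<le> card J"
  obtains i where "i \<in> {1..h}" "\<And>P K. P \<in> \<R> i \<Longrightarrow> K \<in> P \<Longrightarrow> \<not> J \<subseteq> K"
proof -
  have "\<exists>i\<in>{1..h}. \<forall>P\<in>\<R> i. \<forall>K\<in>P. \<not> J \<subseteq> K"
  proof (rule ccontr)
    assume "\<not> ?thesis"
    then have "\<forall>i\<in>{1..h}. \<exists>P. P \<in> \<R> i \<and> (\<exists>K\<in>P. J \<subseteq> K)" by blast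
    then obtain P where P: "\<And>i. i \<in> {1..h} \<Longrightarrow> P i \<in> \<R> i \<and> (\<exists>K\<in>P i. J \<subseteq> K)" by metis
    then have "\<forall>Q\<in>P ` {1..h}. \<exists>K. K \<in> Q \<and> J \<subseteq> K" by blast
    \<comment> \<open>Blocks are chosen per partition rather than per index, because the refinement
      is taken over the set of the \<open>P i\<close>.\<close>
    then obtain f where f: "\<And>Q. Q \<in> P ` {1..h} \<Longrightarrow> f Q \<in> Q \<and> J \<subseteq> f Q" by metis
    have "J \<noteq> {}" using J by auto
    with f have "\<Inter> (f ` P ` {1..h}) \<in> common_refinement (P ` {1..h})"
      unfolding common_refinement by blast
    then have "\<Inter> (f ` P ` {1..h}) \<in> discrete_partition d" using ref P by simp
    then obtain j where "\<Inter> (f ` P ` {1..h}) = {j}" unfolding discrete_partition_def by blast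
    with f have "J \<subseteq> {j}" by blast
    then have "card J \<le> 1" using card_mono[of "{j}" J] by simp
    with J show False by simp
  qed
  then show thesis using that by blast
qed

lemma partitions_into_small_blocks:
  assumes "finite E"
  shows "partitions_into E {K. card K \<le> 1} \<subseteq> {(\<lambda>j. {j}) ` E}"
proof
  fix P assume "P \<in> partitions_into E {K. card K \<le> 1}"
  then have P: "partition_on E P" and small: "\<And>K. K \<in> P \<Longrightarrow> card K \<le> 1"
    by (auto simp: partitions_into_def)
  have single: "\<exists>j. K = {j}" if K: "K \<in> P" for K
  proof -
    \<comment> \<open>The condition \<open>card K \<le> 1\<close> also admits empty and infinite
      sets; neither is a block of a partition of a finite set.\<close>
    have "finite K" "K \<noteq> {}"
      using partition_on_subset[OF P K] assms finite_subset partition_onD3[OF P] K by blast+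
    then have "card K \<noteq> 0" by simp
    with small[OF K] show ?thesis using card_1_singletonE[of K] by (metis le_antisym less_one not_le)
  qed
  have "P = (\<lambda>j. {j}) ` E"
  proof (intro equalityI subsetI)
    fix K assume "K \<in> P"
    with single[OF this] partition_on_subset[OF P this] show "K \<in> (\<lambda>j. {j}) ` E" by auto
  next
    fix K assume "K \<in> (\<lambda>j. {j}) ` E"
    then obtain j where j: "j \<in> E" "K = {j}" by blast
    then obtain L where "L \<in> P" "j \<in> L" using P by (auto simp: partition_on_def)
    with single[of L] j show "K \<in> P" by auto
  qed
  then show "P \<in> {(\<lambda>j. {j}) ` E}" by simp
qed

text \<open>The reduction starts with all \<open>2 ^ d\<close> subsets admissible and with
  \<open>T\<close> as a single product with one block. The index \<open>i\<close> whose partitions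
  split \<open>J\<close> varies with \<open>J\<close>, so the sum of all \<open>k i\<close> serves
  as a common bound. The resulting value does not involve \<open>F\<close>.\<close>

lemma bounds_tensor_rank_reduction_bound:
  fixes F :: "('a, 'm) ring_scheme" and \<R> :: "nat \<Rightarrow> nat set set set"
  assumes F: "field F" and d: "d \<ge> 1" and ne: "\<And>i. i \<in> {1..h} \<Longrightarrow> \<R> i \<noteq> {}"
    and part: "\<And>i P. i \<in> {1..h} \<Longrightarrow> P \<in> \<R> i \<Longrightarrow> partition_on {1..d} P"
    and ref: "\<And>P. (\<And>i. i \<in> {1..h} \<Longrightarrow> P i \<in> \<R> i) \<Longrightarrow>
      common_refinement (P ` {1..h}) = discrete_partition d"
  shows "bounds_tensor_rank F d h \<R> k (reduction_bound (\<Sum>i\<in>{1..h}. k i) (2 ^ d) 1)"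
  unfolding bounds_tensor_rank_def
proof (intro allI impI)
  fix n T
  assume T: "T \<in> tensors F d n" and rank: "\<forall>i\<in>{1..h}. R_rank F d n (\<R> i) T \<le> k i"
  interpret field F by (rule F)
  let ?E = "{1..d}" and ?k = "\<Sum>i\<in>{1..h}. k i"
  have 1: "sum_of F (box ?E n) (block_products F n ?E (partitions_into ?E {K. card K \<le> 1}))
      (reduction_bound ?k (2 ^ d) 1) T"
  proof (rule block_products_reduce)
    fix J assume "J \<subseteq> ?E" "2 \<le> card J"
    from not_coarser_of_common_refinement[OF ref this(2)]
    obtain i where i: "i \<in> {1..h}" and split: "\<And>P K. P \<in> \<R> i \<Longrightarrow> K \<in> P \<Longrightarrow> \<not> J \<subseteq> K" by blast
    have ki: "sum_of F (box ?E n) (block_products F n ?E (\<R> i)) (k i) T"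
      using R_rank_le_iff_sum_of[OF part[OF i] ne[OF i] d T] rank i by blast
    have sub: "\<R> i \<subseteq> partitions_into ?E {K. \<not> J \<subseteq> K}"
      using part[OF i] split by (auto simp: partitions_into_def)
    have "k i \<le> ?k" using i by (intro member_le_sum) auto
    with sum_of_mono[OF ki block_products_mono[OF sub]] show "sum_of F (box ?E n)
        (block_products F n ?E (partitions_into ?E {K. \<not> J \<subseteq> K})) ?k T"
      by (rule sum_of_le)
  next
    have "T \<in> block_products F n ?E (partitions_into ?E (Pow ?E))"
    proof (rule block_productsI[OF _ one_closed])
      show "{?E} \<in> partitions_into ?E (Pow ?E)"
        using d by (auto simp: partitions_into_def intro: partition_on_space)
      show "\<forall>K\<in>{?E}. T \<in> box K n \<rightarrow> carrier F" using T by (simp add: tensors_def)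
      fix x assume x: "x \<in> box ?E n"
      then have "restrict x ?E = x" by (simp add: box_def PiE_restrict)
      moreover have "T x \<in> carrier F" using T x by (auto simp: tensors_def)
      ultimately show "T x = \<one>\<^bsub>F\<^esub> \<otimes>\<^bsub>F\<^esub> (\<Otimes>\<^bsub>F\<^esub>K\<in>{?E}. T (restrict x K))" by simp
    qed
    from sum_of_single[OF this partitions_into_closed]
    show "sum_of F (box ?E n) (block_products F n ?E (partitions_into ?E (Pow ?E))) 1 T" .
  qed (auto simp: card_Pow)
  have 2: "partitions_into ?E {K. card K \<le> 1} \<subseteq> {discrete_partition d}"
    using partitions_into_small_blocks[of ?E] by (simp add: discrete_partition_def)
  have "sum_of F (box ?E n) (block_products F n ?E {discrete_partition d})
      (reduction_bound ?k (2 ^ d) 1) T"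
    by (rule sum_of_mono[OF 1 block_products_mono[OF 2]])
  then show "tensor_rank F d n T \<le> reduction_bound ?k (2 ^ d) 1"
    using tensor_rank_le_iff_sum_of[OF d T] by blast
qed

subsection \<open>Change of field\<close>

lemma block_products_image:
  assumes h: "ring_hom_cring G F h" and E: "\<And>P. P \<in> \<P> \<Longrightarrow> partition_on E P"
    and g: "g \<in> block_products G n E \<P>"
  shows "h \<circ> g \<in> block_products F n E \<P>"
proof -
  interpret ring_hom_cring G F h by (rule h)
  from g obtain P c a where P: "P \<in> \<P>" and c: "c \<in> carrier G"
    and a: "\<forall>K\<in>P. a K \<in> box K n \<rightarrow> carrier G"
    and eq: "\<forall>x\<in>box E n. g x = c \<otimes>\<^bsub>G\<^esub> (\<Otimes>\<^bsub>G\<^esub>K\<in>P. a K (restrict x K))"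
    unfolding block_products_def by blast
  show ?thesis
  proof (rule block_productsI[OF P])
    show "h c \<in> carrier F" using c by simp
    show "\<forall>K\<in>P. (\<lambda>w. h (a K w)) \<in> box K n \<rightarrow> carrier F" using a by (auto simp: Pi_iff)
    fix x assume x: "x \<in> box E n"
    have fac: "(\<lambda>K. a K (restrict x K)) \<in> P \<rightarrow> carrier G"
      using R.block_factors_closed[OF a _ x] partition_on_subset[OF E[OF P]] by blast
    then have "(\<Otimes>\<^bsub>G\<^esub>K\<in>P. a K (restrict x K)) \<in> carrier G" by (rule R.finprod_closed)
    then show "(h \<circ> g) x = h c \<otimes>\<^bsub>F\<^esub> (\<Otimes>\<^bsub>F\<^esub>K\<in>P. h (a K (restrict x K)))"
      using eq x c fac by (simp add: hom_finprod o_def)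
  qed
qed

text \<open>Applying a homomorphism to all factors and scalars keeps the length of a decomposition;
  this carries decompositions from a subfield to the whole field.\<close>

lemma sum_of_block_products_image:
  assumes h: "ring_hom_cring G F h" and E: "\<And>P. P \<in> \<P> \<Longrightarrow> partition_on E P"
    and "sum_of G (box E n) (block_products G n E \<P>) N f"
  shows "sum_of F (box E n) (block_products F n E \<P>) N (h \<circ> f)"
  using assms(3)
proof (induction rule: sum_of.induct)
  case (zero f)
  interpret ring_hom_cring G F h by (rule h)
  show ?case by (rule sum_of.zero) (simp add: zero)
next
  case (weaken N f)
  then show ?case by (simp add: sum_of.weaken)
next
  case (add N f g k)
  interpret ring_hom_cring G F h by (rule h)
  have "f \<in> box E n \<rightarrow> carrier G" "g \<in> box E n \<rightarrow> carrier G"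
    using R.sum_of_closed[OF add.hyps(1)] R.block_products_closed[OF E] add.hyps(2) by blast+
  then show ?case
    using add.hyps(3)
    by (intro sum_of.add[OF add.IH block_products_image[OF h E add.hyps(2)]]) (auto simp: Pi_iff)
qed

text \<open>\<open>Z\<close> collects the finitely many scalars of one fixed product; if the image
  of \<open>h\<close> contains them, each can be pulled back separately. \<open>Z\<close> is chosen
  before \<open>G\<close> and \<open>h\<close>, since the subfield is later generated by such
  sets.\<close>

lemma block_products_preimage:
  fixes F :: "('a, 'm) ring_scheme"
  assumes \<P>: "\<forall>P\<in>\<P>. partition_on E P" and E: "finite E"
    and g: "g \<in> block_products F n E \<P>"
  shows "\<exists>Z \<subseteq> carrier F. countable Z \<and> (\<forall>(G :: 'b ring) h. ring_hom_cring G F h \<longrightarrow>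
      Z \<subseteq> h ` carrier G \<longrightarrow>
      (\<exists>g'. (\<forall>x\<in>box E n. h (g' x) = g x) \<and> g' \<in> block_products G n E \<P>))"
proof -
  from g obtain P c a where P: "P \<in> \<P>" and c: "c \<in> carrier F"
    and a: "\<forall>K\<in>P. a K \<in> box K n \<rightarrow> carrier F"
    and eq: "\<forall>x\<in>box E n. g x = c \<otimes>\<^bsub>F\<^esub> (\<Otimes>\<^bsub>F\<^esub>K\<in>P. a K (restrict x K))"
    unfolding block_products_def by blast
  let ?Z = "insert c (\<Union>K\<in>P. a K ` box K n)"
  have sub: "K \<subseteq> E" if "K \<in> P" for K using partition_on_subset[OF \<P>[rule_format, OF P] that] .
  have fin: "finite (box K n)" if "K \<in> P" for K
    using finite_subset[OF sub[OF that] E] by (simp add: box_def finite_PiE)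
  show ?thesis
  proof (intro exI[of _ ?Z] conjI allI impI)
    show "?Z \<subseteq> carrier F" using c a by blast
    show "countable ?Z"
      using partition_on_finite[OF \<P>[rule_format, OF P] E] fin by (auto intro: countable_finite)
    fix G :: "'b ring" and h
    assume "ring_hom_cring G F h" and Z: "?Z \<subseteq> h ` carrier G"
    then interpret ring_hom_cring G F h by simp
    let ?i = "inv_into (carrier G) h"
    define b where "b K w = ?i (a K w)" for K w
    have i: "?i z \<in> carrier G" "h (?i z) = z" if "z \<in> ?Z" for z
      using subsetD[OF Z that] by (rule inv_into_into, rule f_inv_into_f)
    have a_Z: "a K w \<in> ?Z" if "K \<in> P" "w \<in> box K n" for K w using that by blast
    have b: "\<forall>K\<in>P. b K \<in> box K n \<rightarrow> carrier G" using i(1)[OF a_Z] by (simp add: b_def)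
    let ?g = "\<lambda>x. ?i c \<otimes>\<^bsub>G\<^esub> (\<Otimes>\<^bsub>G\<^esub>K\<in>P. b K (restrict x K))"
    have "h (?g x) = g x" if x: "x \<in> box E n" for x
    proof -
      have fac: "(\<lambda>K. b K (restrict x K)) \<in> P \<rightarrow> carrier G"
        using R.block_factors_closed[OF b sub x] .
      have "(\<Otimes>\<^bsub>F\<^esub>K\<in>P. h (b K (restrict x K))) = (\<Otimes>\<^bsub>F\<^esub>K\<in>P. a K (restrict x K))"
      proof (rule S.finprod_cong'[OF refl])
        show "(\<lambda>K. a K (restrict x K)) \<in> P \<rightarrow> carrier F" by (rule S.block_factors_closed[OF a sub x])
        fix K assume K: "K \<in> P"
        show "h (b K (restrict x K)) = a K (restrict x K)"
          unfolding b_def by (rule i(2)[OF a_Z[OF K restrict_box[OF x sub[OF K]]]])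
      qed
      moreover have "(\<Otimes>\<^bsub>G\<^esub>K\<in>P. b K (restrict x K)) \<in> carrier G" using fac by (rule R.finprod_closed)
      ultimately show ?thesis using eq x i fac by (simp add: hom_finprod o_def)
    qed
    moreover have "?g \<in> block_products G n E \<P>"
      by (rule block_productsI[OF P _ b]) (use i in auto)
    ultimately show "\<exists>g'. (\<forall>x\<in>box E n. h (g' x) = g x) \<and> g' \<in> block_products G n E \<P>"
      by (intro exI[of _ ?g] conjI ballI)
  qed
qed

lemma sum_of_block_products_preimage:
  fixes F :: "('a, 'm) ring_scheme"
  assumes F: "cring F" and \<P>: "\<And>P. P \<in> \<P> \<Longrightarrow> partition_on E P" and E: "finite E"
    and "sum_of F (box E n) (block_products F n E \<P>) N f"
  shows "\<exists>Z \<subseteq> carrier F. countable Z \<and> (\<forall>(G :: 'b ring) h. ring_hom_cring G F h \<longrightarrow>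
      Z \<subseteq> h ` carrier G \<longrightarrow> (\<exists>f'. (\<forall>x\<in>box E n. h (f' x) = f x) \<and>
        sum_of G (box E n) (block_products G n E \<P>) N f'))"
  using assms(4)
proof (induction rule: sum_of.induct)
  case (zero f)
  have "\<exists>f'. (\<forall>x\<in>box E n. h (f' x) = f x) \<and> sum_of G (box E n) (block_products G n E \<P>) 0 f'"
    if "ring_hom_cring G F h" for G :: "'b ring" and h
  proof -
    interpret ring_hom_cring G F h by (rule that)
    show ?thesis using zero by (intro exI[of _ "\<lambda>_. \<zero>\<^bsub>G\<^esub>"]) (auto intro: sum_of.zero)
  qed
  then show ?case by (intro exI[of _ "{}"]) simp
next
  case (weaken N f)
  then show ?case by (meson sum_of.weaken)
next
  case (add N f g k)
  from add.IH obtain Z where Z: "Z \<subseteq> carrier F" "countable Z"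
    and f: "\<forall>(G :: 'b ring) h. ring_hom_cring G F h \<longrightarrow> Z \<subseteq> h ` carrier G \<longrightarrow>
      (\<exists>f'. (\<forall>x\<in>box E n. h (f' x) = f x) \<and> sum_of G (box E n) (block_products G n E \<P>) N f')"
    by (elim exE conjE)
  have "\<forall>P\<in>\<P>. partition_on E P" using \<P> by blast
  from block_products_preimage[OF this E add.hyps(2)]
  obtain Z' where Z': "Z' \<subseteq> carrier F" "countable Z'"
    and g: "\<forall>(G :: 'b ring) h. ring_hom_cring G F h \<longrightarrow> Z' \<subseteq> h ` carrier G \<longrightarrow>
      (\<exists>g'. (\<forall>x\<in>box E n. h (g' x) = g x) \<and> g' \<in> block_products G n E \<P>)"
    by (elim exE conjE)
  have "\<exists>k'. (\<forall>x\<in>box E n. h (k' x) = k x) \<and> sum_of G (box E n) (block_products G n E \<P>) (Suc N) k'"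
    if h: "ring_hom_cring G F h" and ZZ: "Z \<union> Z' \<subseteq> h ` carrier G" for G :: "'b ring" and h
  proof -
    interpret ring_hom_cring G F h by (rule h)
    have sub: "Z \<subseteq> h ` carrier G" "Z' \<subseteq> h ` carrier G" using ZZ by blast+
    obtain f' where f': "\<forall>x\<in>box E n. h (f' x) = f x"
      "sum_of G (box E n) (block_products G n E \<P>) N f'"
      using f[rule_format, OF h sub(1)] by (elim exE conjE)
    obtain g' where g': "\<forall>x\<in>box E n. h (g' x) = g x" "g' \<in> block_products G n E \<P>"
      using g[rule_format, OF h sub(2)] by (elim exE conjE)
    let ?k = "\<lambda>x. f' x \<oplus>\<^bsub>G\<^esub> g' x"
    have "f' \<in> box E n \<rightarrow> carrier G" "g' \<in> box E n \<rightarrow> carrier G"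
      using R.sum_of_closed[OF f'(2)] R.block_products_closed[OF \<P>] g'(2) by blast+
    then have "\<forall>x\<in>box E n. h (?k x) = k x"
      using f'(1) g'(1) add.hyps(3) by (simp add: Pi_iff)
    moreover have "sum_of G (box E n) (block_products G n E \<P>) (Suc N) ?k"
      by (rule sum_of.add[OF f'(2) g'(2)]) simp
    ultimately show ?thesis by (intro exI[of _ ?k] conjI)
  qed
  moreover have "Z \<union> Z' \<subseteq> carrier F" "countable (Z \<union> Z')" using Z Z' by auto
  ultimately show ?case by (intro exI[of _ "Z \<union> Z'"] conjI allI impI)
qed

section \<open>Countable subfields and their copies in \<open>nat\<close>\<close>

text \<open>The generated field is covered by countably many levels, each arising from the previous
  one by a single round of field operations, so each level is countable.\<close>

lemma (in field) countable_generate_field: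
  assumes "countable H"
  shows "countable (generate_field R H)"
proof -
  \<comment> \<open>Keeping \<open>X\<close> makes the levels increase, so two operands reach a
    common level. Applying \<open>inv\<close> to zero as well is harmless, because the levels only
    have to cover the generated field.\<close>
  define close where "close X = X \<union> (\<lambda>x. \<ominus> x) ` X \<union> (\<lambda>x. inv x) ` X \<union>
    (\<lambda>(x, y). x \<oplus> y) ` (X \<times> X) \<union> (\<lambda>(x, y). x \<otimes> y) ` (X \<times> X)" for X
  define level where "level i = (close ^^ i) (insert \<one> H)" for i
  have level_Suc: "level (Suc i) = close (level i)" for i by (simp add: level_def)
  have "countable (level i)" for i
    by (induction i) (use assms in \<open>auto simp: level_def close_def\<close>)
  then have "countable (\<Union>i. level i)" by blast
  moreover have "\<exists>i. x \<in> level i" if "x \<in> generate_field R H" for x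
  proof -
    have mono: "level i \<subseteq> level j" if "i \<le> j" for i j
      using that by (induction rule: dec_induct) (auto simp: level_Suc close_def)
    from that show ?thesis
    proof (induction rule: generate_field.induct)
      case one
      show ?case by (rule exI[of _ 0]) (simp add: level_def)
    next
      case (incl h)
      then show ?case by (intro exI[of _ 0]) (simp add: level_def)
    next
      case (a_inv h)
      then obtain i where "h \<in> level i" by blast
      then have "\<ominus> h \<in> level (Suc i)" by (simp add: level_Suc close_def)
      then show ?case ..
    next
      case (m_inv h)
      then obtain i where "h \<in> level i" by blast
      then have "inv h \<in> level (Suc i)" by (simp add: level_Suc close_def)
      then show ?case ..
    next
      case (eng_add x y)
      then obtain i j where "x \<in> level i" "y \<in> level j" by blast
      then have "x \<in> level (max i j)" "y \<in> level (max i j)"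
        using mono[of i "max i j"] mono[of j "max i j"] by auto
      then have "x \<oplus> y \<in> level (Suc (max i j))" by (force simp: level_Suc close_def)
      then show ?case ..
    next
      case (eng_mult x y)
      then obtain i j where "x \<in> level i" "y \<in> level j" by blast
      then have "x \<in> level (max i j)" "y \<in> level (max i j)"
        using mono[of i "max i j"] mono[of j "max i j"] by auto
      then have "x \<otimes> y \<in> level (Suc (max i j))" by (force simp: level_Suc close_def)
      then show ?case ..
    qed
  qed
  then have "generate_field R H \<subseteq> (\<Union>i. level i)" by blast
  ultimately show ?thesis by (rule countable_subset[rotated])
qed

text \<open>The structure of the countable field generated by \<open>Z\<close> is transported to
  \<open>nat\<close> along the injection \<open>to_nat_on\<close>; \<open>h\<close> is the inverse
  of that map, followed by the inclusion.\<close>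

lemma (in field) countable_subfield_nat:
  assumes Z: "Z \<subseteq> carrier R" "countable Z"
  obtains G :: "nat ring" and h where "field G" "ring_hom_cring G R h" "inj_on h (carrier G)"
    "Z \<subseteq> h ` carrier G"
proof -
  let ?K = "R\<lparr>carrier := generate_field R Z\<rparr>"
  let ?e = "to_nat_on (generate_field R Z)"
  let ?G = "image_ring ?e ?K"
  interpret K: field ?K by (rule generate_field_is_field[OF Z(1)])
  have e: "inj_on ?e (carrier ?K)"
    using countable_generate_field[OF Z(2)] by (simp add: inj_on_to_nat_on)
  let ?h = "inv_into (carrier ?K) ?e"
  have G: "field ?G" by (rule K.inj_imp_image_ring_is_field[OF e])
  have iso: "?h \<in> ring_iso ?G ?K"
    by (rule ring_iso_set_sym[OF K.ring_axioms inj_imp_image_ring_iso[OF e]])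
  then have bij: "bij_betw ?h (carrier ?G) (generate_field R Z)" and hom: "?h \<in> ring_hom ?G ?K"
    by (auto simp: ring_iso_def)
  have "?h \<in> ring_hom ?G R"
    using hom generate_field_incl[OF Z(1)] by (auto simp: ring_hom_def)
  then have "ring_hom_cring ?G R ?h"
    using fieldE(1)[OF G] is_cring by (simp add: ring_hom_cring_def ring_hom_cring_axioms_def)
  moreover have "Z \<subseteq> ?h ` carrier ?G"
    using bij by (auto simp: bij_betw_def intro: generate_field.incl)
  ultimately show thesis using that G bij bij_betw_imp_inj_on by blast
qed

section \<open>Descent to a countable field and return\<close>

theorem corollary1p11:
  fixes F :: "('a, 'm) ring_scheme"
    and d h :: nat
    and R :: "nat \<Rightarrow> nat set set set"
    and k n :: "nat \<Rightarrow> nat"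
    and T :: "(nat \<Rightarrow> nat) \<Rightarrow> 'a"
  assumes "d \<ge> 2" and "h \<ge> 1"
    and "\<And>i. i \<in> {1..h} \<Longrightarrow> R i \<noteq> {}"
    and "\<And>i P. i \<in> {1..h} \<Longrightarrow> P \<in> R i \<Longrightarrow> partition_on {1..d} P"
    and "\<And>P. (\<And>i. i \<in> {1..h} \<Longrightarrow> P i \<in> R i) \<Longrightarrow> common_refinement (P ` {1..h}) = discrete_partition d"
    and "\<And>i. i \<in> {1..h} \<Longrightarrow> k i \<ge> 1"
    and "field F"
    and "\<And>j. j \<in> {1..d} \<Longrightarrow> n j \<ge> 1"
    and "T \<in> tensors F d n"
    and "\<And>i. i \<in> {1..h} \<Longrightarrow> R_rank F d n (R i) T \<le> k i"
  shows "tensor_rank F d n T \<le> rank_constant d h R k"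
proof -
  let ?E = "{1..d}"
  interpret F: field F by (rule assms(7))
  have d: "1 \<le> d" using assms(1) by simp
  have discrete: "P \<in> {discrete_partition d} \<Longrightarrow> partition_on ?E P" for P
    by (simp add: discrete_partition_def partition_on_singletons)
  have "\<exists>Z \<subseteq> carrier F. countable Z \<and> (\<forall>(G :: nat ring) g. ring_hom_cring G F g \<longrightarrow>
      Z \<subseteq> g ` carrier G \<longrightarrow> (\<exists>f'. (\<forall>x\<in>box ?E n. g (f' x) = T x) \<and>
        sum_of G (box ?E n) (block_products G n ?E (R i)) (k i) f'))" if i: "i \<in> {1..h}" for i
  proof -
    have *: "sum_of F (box ?E n) (block_products F n ?E (R i)) (k i) T"
      using F.R_rank_le_iff_sum_of[OF assms(4)[OF i] assms(3)[OF i] d assms(9)] assms(10)[OF i]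
      by simp
    show ?thesis
      by (rule sum_of_block_products_preimage[OF F.is_cring assms(4)[OF i] finite_atLeastAtMost *])
  qed
  then obtain Z where Z: "\<And>i. i \<in> {1..h} \<Longrightarrow> Z i \<subseteq> carrier F" "\<And>i. i \<in> {1..h} \<Longrightarrow> countable (Z i)"
    and pre: "\<And>i (G :: nat ring) g. i \<in> {1..h} \<Longrightarrow> ring_hom_cring G F g \<Longrightarrow> Z i \<subseteq> g ` carrier G \<Longrightarrow>
      \<exists>f'. (\<forall>x\<in>box ?E n. g (f' x) = T x) \<and>
        sum_of G (box ?E n) (block_products G n ?E (R i)) (k i) f'"
    by metis
  \<comment> \<open>One subfield must contain the scalars of the decompositions for all
    \<open>i\<close> at once. The entries of \<open>T\<close> are added so that \<open>T\<close> has
    a lift \<open>T'\<close> that does not depend on \<open>i\<close>.\<close>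
  let ?Z = "T ` box ?E n \<union> (\<Union>i\<in>{1..h}. Z i)"
  have "finite (box ?E n)" by (simp add: box_def finite_PiE)
  then have "countable ?Z" using Z(2) by (auto intro: countable_finite)
  moreover have "?Z \<subseteq> carrier F" using Z(1) assms(9) unfolding tensors_def by blast
  ultimately obtain G :: "nat ring" and g where G: "field G" and g: "ring_hom_cring G F g"
    and inj: "inj_on g (carrier G)" and sub: "?Z \<subseteq> g ` carrier G"
    using F.countable_subfield_nat by metis
  interpret G: field G by (rule G)
  define T' where "T' x = inv_into (carrier G) g (T x)" for x
  have T': "T' x \<in> carrier G" "g (T' x) = T x" if "x \<in> box ?E n" for x
  proof -
    have "T x \<in> g ` carrier G" using that sub by blast
    then show "T' x \<in> carrier G" "g (T' x) = T x"
      unfolding T'_def by (rule inv_into_into, rule f_inv_into_f)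
  qed
  have tensor: "T' \<in> tensors G d n" using T'(1) by (auto simp: tensors_def)
  have "R_rank G d n (R i) T' \<le> k i" if i: "i \<in> {1..h}" for i
  proof -
    obtain f where f: "\<forall>x\<in>box ?E n. g (f x) = T x"
      and sum: "sum_of G (box ?E n) (block_products G n ?E (R i)) (k i) f"
      using pre[OF i g] sub i by blast
    have "f \<in> box ?E n \<rightarrow> carrier G"
      using G.sum_of_closed[OF sum G.block_products_closed] assms(4)[OF i] by blast
    \<comment> \<open>The lift \<open>f\<close> comes from the decomposition for \<open>i\<close>;
      injectivity of \<open>g\<close> identifies it with \<open>T'\<close>, so one tensor satisfies
      all rank bounds over \<open>G\<close>.\<close>
    then have "f x = T' x" if "x \<in> box ?E n" for x
      using inj_onD[OF inj, of "f x" "T' x"] f T' that by auto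
    from sum_of_cong[OF sum this] show ?thesis
      using G.R_rank_le_iff_sum_of[OF assms(4)[OF i] assms(3)[OF i] d tensor] by simp
  qed
  \<comment> \<open>\<open>rank_constant\<close> is a \<open>LEAST\<close>; its defining property
    follows once some number works for all fields with carrier in \<open>nat\<close>, and
    \<open>reduction_bound\<close> provides one.\<close>
  moreover have "bounds_tensor_rank G d h R k (rank_constant d h R k)"
  proof -
    have "\<forall>F :: nat ring. field F \<longrightarrow>
        bounds_tensor_rank F d h R k (reduction_bound (\<Sum>i\<in>{1..h}. k i) (2 ^ d) 1)"
    proof (intro allI impI)
      fix H :: "nat ring"
      assume "field H"
      then show "bounds_tensor_rank H d h R k (reduction_bound (\<Sum>i\<in>{1..h}. k i) (2 ^ d) 1)"
        using d assms(3,4,5) by (rule bounds_tensor_rank_reduction_bound)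
    qed
    then have "\<forall>F :: nat ring. field F \<longrightarrow> bounds_tensor_rank F d h R k (rank_constant d h R k)"
      unfolding rank_constant_def by (rule LeastI)
    then show ?thesis using G by blast
  qed
  ultimately have "tensor_rank G d n T' \<le> rank_constant d h R k"
    using assms(8) tensor unfolding bounds_tensor_rank_def by blast
  then have "sum_of G (box ?E n) (block_products G n ?E {discrete_partition d})
      (rank_constant d h R k) T'"
    using G.tensor_rank_le_iff_sum_of[OF d tensor] by blast
  from sum_of_block_products_image[OF g discrete this]
  have "sum_of F (box ?E n) (block_products F n ?E {discrete_partition d})
      (rank_constant d h R k) (g \<circ> T')" .
  then have "sum_of F (box ?E n) (block_products F n ?E {discrete_partition d})
      (rank_constant d h R k) T"
    by (rule sum_of_cong) (simp add: T'(2))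
  then show ?thesis
    using F.tensor_rank_le_iff_sum_of[OF d assms(9)] by blast
qed

end
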